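(* For almost every Galton–Watson tree $\mathbf T$, the limit-uniform and invasion measures on $\mathbf T$ have the same entropy; that is, for almost every $\mathbf T$, every exponentially small set $S\subset\partial\mathbf T$ satisfies $\nu_{\mathbf T}(S)=0$.
   Context: The offspring variable $Z$ takes values in $\{1,2,\dots\}$, with $\mu:=\mathbf E[Z]>1$ and $\mathbf E[Z^2]<\infty$. Let $\mathcal V=\bigcup_{n\ge 0}\mathbb N^n$ be the vertex set of the Ulam–Harris tree, with root $\mathbf 0=\emptyset$. On $\Omega=(\mathbb N\times[0,1])^{\mathcal V}$ let $\mathbf P$ be the probability making the coordinates $(\deg_v,U_v)$, $v\in\mathcal V$, i.i.d. with the law of $(Z,U)$, where $U$ is uniform on $[0,1]$ and independent of $Z$. The Galton–Watson tree $\mathbf T$ is the random subtree containing $\mathbf 0$ and, for each $v\in\mathbf T$, exactly its first $\deg_v$ children. $\partial T$ is the set of infinite non-backtracking paths $\gamma=(\mathbf 0,\gamma_1,\gamma_2,\dots)$ from the root of $T$, with the $\sigma$-field generated by the sets $\{\gamma:\gamma_n=v\}$. Exponentially small sets: for $S\subset\partial T$, $S_n$ is the set of vertices at height $n$ lying on paths in $S$; $S$ is exponentially small if there are $\varepsilon\in(0,\mu)$ and a constant $c<\infty$ with $|S_n|\le c(\mu-\varepsilon)^n$ for all $n$ (here $\mu$ is the branching number of $T$, which for almost every Galton–Watson tree equals $\mathbf E[Z]$). $\nu_T(S)=0$ means that $S$ is a $\nu_T$-null set. The limit-uniform and invasion measures on $T$ are said to have the same entropy if every exponentially small $S$ has $\nu_T(S)=0$.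 Invasion percolation on a tree $T$: $I^T_0=\{\mathbf 0\}$, and $I^T_{n+1}$ consists of $I^T_n$ together with the vertex of minimal weight $U_v$ among the vertices of $T$ adjacent to $I^T_n$ and not in it; $I^T=\bigcup_n I^T_n$. For almost every Galton–Watson tree $T$, $I^T$ almost surely contains a unique infinite non-backtracking path $\gamma^T$ from $\mathbf 0$; $\nu_T$ (the invasion measure) is the law of $\gamma^T$ given $T$. *)

theory Defs
  imports "HOL-Probability.Probability"
begin

text \<open>
  Vertices of the Ulam--Harris tree are finite sequences of naturals, the root is the empty list.
  The children of \<open>v\<close> are \<open>v @ [i]\<close>; they are numbered from 0, so the first \<open>d\<close> children are
  those with \<open>i < d\<close>.
\<close>

type_synonym vertex = "nat list"

definition adj :: "vertex \<Rightarrow> vertex \<Rightarrow> bool" where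
  "adj u v \<longleftrightarrow> (\<exists>i. v = u @ [i]) \<or> (\<exists>i. u = v @ [i])"

inductive_set gw_tree :: "(vertex \<Rightarrow> nat) \<Rightarrow> vertex set" for deg :: "vertex \<Rightarrow> nat" where
  root: "[] \<in> gw_tree deg"
| child: "v \<in> gw_tree deg \<Longrightarrow> i < deg v \<Longrightarrow> v @ [i] \<in> gw_tree deg"

definition unif01 :: "real measure" where
  "unif01 = restrict_space lborel {0..1}"

definition gw_measure :: "nat pmf \<Rightarrow> (vertex \<Rightarrow> nat \<times> real) measure" where
  "gw_measure p = PiM UNIV (\<lambda>_. measure_pmf p \<Otimes>\<^sub>M unif01)"

text \<open>
  Infinite non-backtracking paths from the root that stay in the vertex set \<open>A\<close>. For a tree
  \<open>T\<close>, \<open>rays T\<close> is its boundary.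
\<close>

definition rays :: "vertex set \<Rightarrow> (nat \<Rightarrow> vertex) set" where
  "rays A = {\<gamma>. \<gamma> 0 = [] \<and> (\<forall>n. \<gamma> n \<in> A) \<and> (\<forall>n. adj (\<gamma> n) (\<gamma> (Suc n)))
                \<and> (\<forall>n. \<gamma> (Suc (Suc n)) \<noteq> \<gamma> n)}"

definition ray_space :: "vertex set \<Rightarrow> (nat \<Rightarrow> vertex) measure" where
  "ray_space T = sigma (rays T) {{\<gamma> \<in> rays T. \<gamma> n = v} | n v. True}"

definition outer_boundary :: "vertex set \<Rightarrow> vertex set \<Rightarrow> vertex set" where
  "outer_boundary T I = {v \<in> T - I. \<exists>u\<in>I. adj u v}"

primrec invasion_step :: "vertex set \<Rightarrow> (vertex \<Rightarrow> real) \<Rightarrow> nat \<Rightarrow> vertex set" where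
  "invasion_step T U 0 = {[]}"
| "invasion_step T U (Suc n) =
     insert (ARG_MIN U v. v \<in> outer_boundary T (invasion_step T U n)) (invasion_step T U n)"

definition invasion_cluster :: "vertex set \<Rightarrow> (vertex \<Rightarrow> real) \<Rightarrow> vertex set" where
  "invasion_cluster T U = (\<Union>n. invasion_step T U n)"

text \<open>
  On the exceptional null set of weights for which the cluster does not contain a unique ray,
  the path is set to a ray of \<open>T\<close> that does not depend on \<open>U\<close>. This keeps the map measurable on
  every locally finite tree without leaves, as the push-forward \<open>distr\<close> below requires.
\<close>

definition invasion_path :: "vertex set \<Rightarrow> (vertex \<Rightarrow> real) \<Rightarrow> nat \<Rightarrow> vertex" where
  "invasion_path T U =
     (if \<exists>!\<gamma>. \<gamma> \<in> rays (invasion_cluster T U)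
      then THE \<gamma>. \<gamma> \<in> rays (invasion_cluster T U)
      else SOME \<gamma>. \<gamma> \<in> rays T)"

text \<open>
  The tree is a function of the degrees, which are independent of the weights; hence the law of
  the invasion path given the tree \<open>T\<close> is its law for fixed \<open>T\<close> and i.i.d. uniform weights.
\<close>

definition invasion_measure :: "vertex set \<Rightarrow> (nat \<Rightarrow> vertex) measure" where
  "invasion_measure T = distr (PiM UNIV (\<lambda>_. unif01)) (ray_space T) (invasion_path T)"

definition level :: "(nat \<Rightarrow> vertex) set \<Rightarrow> nat \<Rightarrow> vertex set" where
  "level S n = {v. length v = n \<and> (\<exists>\<gamma>\<in>S. v \<in> range \<gamma>)}"

text \<open>
  In a tree \<open>gw_tree deg\<close> every vertex has finitely many children, so for \<open>S \<subseteq> rays (gw_tree deg)\<close>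
  the levels are finite and \<open>card\<close> is the true cardinality.
\<close>

definition exponentially_small :: "real \<Rightarrow> (nat \<Rightarrow> vertex) set \<Rightarrow> bool" where
  "exponentially_small \<mu> S \<longleftrightarrow>
     (\<exists>\<epsilon> c. 0 < \<epsilon> \<and> \<epsilon> < \<mu> \<and> (\<forall>n. real (card (level S n)) \<le> c * (\<mu> - \<epsilon>) ^ n))"

text \<open>
  Exponentially small sets need not be measurable; the completion makes ``null set'' mean
  ``contained in a measurable set of measure zero''.
\<close>

definition same_entropy :: "real \<Rightarrow> vertex set \<Rightarrow> bool" where
  "same_entropy \<mu> T \<longleftrightarrow>
     (\<forall>S \<subseteq> rays T. exponentially_small \<mu> S \<longrightarrow> S \<in> null_sets (completion (invasion_measure T)))"

end

theory Submission
  imports Defs "HOL-Library.Sublist"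
begin

text \<open>
  Along the invasion path all but finitely many weights are at most \<open>a\<close>, for every \<open>a > 1/\<mu>\<close>.
  Hence, for every \<open>k\<close>, the paths whose weights beyond height \<open>k\<close> are at most \<open>a\<close> meet an
  exponentially small set with probability at most \<open>|S\<^sub>n| a^(n - k)\<close>, which tends to 0 if \<open>a\<close> is
  chosen with \<open>a (\<mu> - \<epsilon>) < 1\<close>.

  That the cluster \<open>I\<close> has finitely many weights above \<open>a\<close> follows from an annealed count. Let \<open>A\<^sub>v\<close> be
  the event that \<open>v \<in> I\<close> and \<open>U\<^sub>v > a\<close>, and \<open>B\<^sub>v\<close> the event that the first child of \<open>v\<close> starts
  arbitrarily long paths of weights at most \<open>a\<close>. Once \<open>v\<close> is invaded and \<open>B\<^sub>v\<close> holds, no weight above \<open>a\<close> is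
  ever accepted again, so the events \<open>A\<^sub>v \<inter> B\<^sub>v\<close> are disjoint. As \<open>A\<^sub>v\<close> and \<open>B\<^sub>v\<close> are independent and
  \<open>P(B\<^sub>v) \<ge> h > 0\<close> (percolation at level \<open>a\<close> is a supercritical branching process), the sum of
  the \<open>P(A\<^sub>v)\<close> is at most \<open>1/h\<close>, and Borel--Cantelli applies.

  It remains to exclude that the cluster contains several rays. Critical percolation (level \<open>1/\<mu>\<close>) has
  no infinite path, so by the previous paragraph the maximal weight along each ray is attained.
\<close>

section \<open>Invasion percolation on a fixed tree\<close>

lemma gw_tree_snoc_iff: "v @ [i] \<in> gw_tree d \<longleftrightarrow> v \<in> gw_tree d \<and> i < d v"
  by (subst gw_tree.simps) auto

lemma gw_tree_append_iff:
  "v @ w \<in> gw_tree d \<longleftrightarrow> v \<in> gw_tree d \<and> w \<in> gw_tree (\<lambda>u. d (v @ u))"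
proof (induction w rule: rev_induct)
  case Nil
  then show ?case by (simp add: gw_tree.root)
next
  case (snoc i w)
  then show ?case
    using gw_tree_snoc_iff[of "v @ w" i d] gw_tree_snoc_iff[of w i "\<lambda>u. d (v @ u)"] by auto
qed

lemma gw_tree_Cons_iff: "i # w \<in> gw_tree d \<longleftrightarrow> i < d [] \<and> w \<in> gw_tree (\<lambda>u. d (i # u))"
  using gw_tree_append_iff[of "[i]" w d] gw_tree_snoc_iff[of "[]" i d] by (simp add: gw_tree.root)

section \<open>Finite subtrees around the root, their outer boundaries, and the steps of the
  invasion\<close>

definition finite_subtree :: "(vertex \<Rightarrow> nat) \<Rightarrow> vertex set \<Rightarrow> bool" where
  "finite_subtree d F \<longleftrightarrow>
     finite F \<and> [] \<in> F \<and> F \<subseteq> gw_tree d \<and> (\<forall>v i. v @ [i] \<in> F \<longrightarrow> v \<in> F)"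

lemma finite_subtree_append: "finite_subtree d F \<Longrightarrow> v @ w \<in> F \<Longrightarrow> v \<in> F"
proof (induction w rule: rev_induct)
  case (snoc i w)
  from snoc.prems have "(v @ w) @ [i] \<in> F" by simp
  with snoc.prems(1) have "v @ w \<in> F" unfolding finite_subtree_def by blast
  with snoc show ?case by blast
qed simp

text \<open>Adjacency is symmetric, so a boundary vertex could also be the parent of a vertex of
  \<open>F\<close>. Closure of \<open>F\<close> under parents rules this out.\<close>

lemma outer_boundary_finite_subtree:
  assumes "finite_subtree d F"
  shows "outer_boundary (gw_tree d) F = {v @ [i] | v i. v \<in> F \<and> i < d v} - F"
  using assms by (auto simp: outer_boundary_def finite_subtree_def adj_def gw_tree_snoc_iff)

lemma finite_outer_boundary:
  assumes "finite F"
  shows "finite (outer_boundary (gw_tree d) F)"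
proof -
  have "outer_boundary (gw_tree d) F \<subseteq> (\<lambda>(v, i). v @ [i]) ` (SIGMA v:F. {..<d v}) \<union> butlast ` F"
  proof
    fix v assume "v \<in> outer_boundary (gw_tree d) F"
    then obtain u where u: "u \<in> F" "v \<in> gw_tree d" "adj u v" by (auto simp: outer_boundary_def)
    from u(3) consider i where "v = u @ [i]" | i where "u = v @ [i]" by (auto simp: adj_def)
    then show "v \<in> (\<lambda>(v, i). v @ [i]) ` (SIGMA v:F. {..<d v}) \<union> butlast ` F"
    proof cases
      case 1
      with u show ?thesis by (auto simp: gw_tree_snoc_iff)
    next
      case 2
      then have "v = butlast u" by simp
      with u(1) show ?thesis by blast
    qed
  qed
  then show ?thesis by (rule finite_subset) (use assms in auto)
qed

text \<open>First exit: for the least \<open>k\<close> whose prefix lies outside \<open>F\<close>,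
  the prefix one shorter is still in \<open>F\<close>, so the two are adjacent across the
  boundary.\<close>

lemma outer_boundary_on_path:
  assumes F: "finite_subtree d F" and v: "v \<in> F" and vw: "v @ w \<in> gw_tree d" "v @ w \<notin> F"
  obtains k where "0 < k" "k \<le> length w" "v @ take k w \<in> outer_boundary (gw_tree d) F"
proof -
  define k where "k = (LEAST k. v @ take k w \<notin> F)"
  have k: "v @ take k w \<notin> F" unfolding k_def
    by (rule LeastI[of _ "length w"]) (use vw in simp)
  have le: "k \<le> length w" unfolding k_def by (rule Least_le) (use vw in simp)
  have "k \<noteq> 0" using k v by (cases k) auto
  then obtain j where j: "k = Suc j" using not0_implies_Suc by blast
  have "v @ take j w \<in> F" using not_less_Least[of j "\<lambda>k. v @ take k w \<notin> F"] j k_def by auto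
  moreover have "v @ take k w = (v @ take j w) @ [w ! j]"
    using j le by (simp add: take_Suc_conv_app_nth)
  moreover have "v @ take k w \<in> gw_tree d"
    using vw(1) gw_tree_append_iff[of "v @ take k w" "drop k w" d] by simp
  ultimately have "v @ take k w \<in> outer_boundary (gw_tree d) F"
    using k by (auto simp: outer_boundary_def adj_def)
  with that \<open>k \<noteq> 0\<close> le show thesis by blast
qed

lemma replicate_in_gw_tree: "(\<And>v. 0 < d v) \<Longrightarrow> replicate n 0 \<in> gw_tree d"
proof (induction n)
  case (Suc n)
  then have "replicate n 0 @ [0] \<in> gw_tree d" by (simp add: gw_tree_snoc_iff)
  then show ?case by (simp add: replicate_append_same)
qed (simp add: gw_tree.root)

text \<open>Positive degrees keep the path of first children inside the tree forever, so it has to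
  leave the finite set \<open>F\<close>.\<close>

lemma outer_boundary_nonempty:
  assumes F: "finite_subtree d F" and d: "\<And>v. 0 < d v"
  shows "outer_boundary (gw_tree d) F \<noteq> {}"
proof -
  have "infinite (range (\<lambda>n. replicate n (0::nat)))"
    by (rule range_inj_infinite) (rule injI, metis length_replicate)
  then obtain n where n: "replicate n 0 \<notin> F"
    using F by (metis finite_subtree_def finite_subset image_subsetI)
  show ?thesis
    by (rule outer_boundary_on_path[OF F, of "[]" "replicate n 0"])
       (use F n replicate_in_gw_tree[of d, OF d] in \<open>auto simp: finite_subtree_def\<close>)
qed

lemma arg_min_outer_boundary:
  fixes U :: "vertex \<Rightarrow> real"
  assumes F: "finite_subtree d F" and d: "\<And>v. 0 < d v"
  shows "(ARG_MIN U v. v \<in> outer_boundary (gw_tree d) F) \<in> outer_boundary (gw_tree d) F"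
    and "w \<in> outer_boundary (gw_tree d) F \<Longrightarrow>
      U (ARG_MIN U v. v \<in> outer_boundary (gw_tree d) F) \<le> U w"
proof -
  let ?B = "outer_boundary (gw_tree d) F"
  obtain x where "is_arg_min U (\<lambda>v. v \<in> ?B) x"
    using ex_is_arg_min_if_finite[OF finite_outer_boundary outer_boundary_nonempty[OF F d]] F
    unfolding finite_subtree_def by blast
  then have *: "is_arg_min U (\<lambda>v. v \<in> ?B) (ARG_MIN U v. v \<in> ?B)"
    unfolding arg_min_def by (rule someI)
  then show "(ARG_MIN U v. v \<in> ?B) \<in> ?B" by (simp add: is_arg_min_def)
  show "U (ARG_MIN U v. v \<in> ?B) \<le> U w" if "w \<in> ?B"
    using * that by (auto simp: is_arg_min_def not_less)
qed

lemma finite_subtree_invasion_step: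
  assumes d: "\<And>v. 0 < d v"
  shows "finite_subtree d (invasion_step (gw_tree d) U n)"
proof (induction n)
  case 0
  then show ?case by (simp add: finite_subtree_def gw_tree.root)
next
  case (Suc n)
  let ?F = "invasion_step (gw_tree d) U n"
  let ?x = "ARG_MIN U v. v \<in> outer_boundary (gw_tree d) ?F"
  have "?x \<in> {v @ [i] | v i. v \<in> ?F \<and> i < d v} - ?F"
    using arg_min_outer_boundary(1)[OF Suc d] unfolding outer_boundary_finite_subtree[OF Suc] .
  with Suc show ?case by (auto simp: finite_subtree_def gw_tree_snoc_iff)
qed

lemma invasion_step_mono: "m \<le> n \<Longrightarrow> invasion_step T U m \<subseteq> invasion_step T U n"
  by (rule lift_Suc_mono_le[of "invasion_step T U"]) auto

text \<open>Picks the moment at which \<open>v\<close> enters. The first step set containing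
  \<open>v\<close> has a successor index because step 0 holds only the root, so \<open>v\<close> was
  the minimiser chosen there.\<close>

lemma invasion_clusterE:
  assumes d: "\<And>v. 0 < d v" and v: "v \<in> invasion_cluster (gw_tree d) U" "v \<noteq> []"
  obtains n where "v \<in> outer_boundary (gw_tree d) (invasion_step (gw_tree d) U n)"
    and "v \<in> invasion_step (gw_tree d) U (Suc n)"
    and "\<And>w. w \<in> outer_boundary (gw_tree d) (invasion_step (gw_tree d) U n) \<Longrightarrow> U v \<le> U w"
proof -
  let ?I = "invasion_step (gw_tree d) U"
  define m where "m = (LEAST n. v \<in> ?I n)"
  have m: "v \<in> ?I m" unfolding m_def
    by (rule LeastI_ex) (use v in \<open>auto simp: invasion_cluster_def\<close>)
  then obtain n where n: "m = Suc n" using v(2) by (cases m) auto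
  have "v \<notin> ?I n" using not_less_Least[of n "\<lambda>n. v \<in> ?I n"] n m_def by auto
  then have "v = (ARG_MIN U v. v \<in> outer_boundary (gw_tree d) (?I n))" using m n by auto
  then show thesis
    using that[of n] arg_min_outer_boundary[OF finite_subtree_invasion_step[of d U n, OF d] d, where U=U]
      m n by metis
qed

lemma invasion_cluster_subset:
  assumes d: "\<And>v. 0 < d v"
  shows "invasion_cluster (gw_tree d) U \<subseteq> gw_tree d"
  using finite_subtree_invasion_step[of d U, OF d]
  unfolding invasion_cluster_def finite_subtree_def by blast

lemma invasion_cluster_append:
  assumes d: "\<And>v. 0 < d v" and vw: "v @ w \<in> invasion_cluster (gw_tree d) U"
  shows "v \<in> invasion_cluster (gw_tree d) U"
proof -
  obtain n where "v @ w \<in> invasion_step (gw_tree d) U n"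
    using vw by (auto simp: invasion_cluster_def)
  then have "v \<in> invasion_step (gw_tree d) U n"
    by (rule finite_subtree_append[OF finite_subtree_invasion_step[of d U n, OF d]])
  then show ?thesis by (auto simp: invasion_cluster_def)
qed

text \<open>The chosen minimiser lies in the outer boundary and is therefore new, so step
  \<open>n\<close> has exactly \<open>n + 1\<close> vertices.\<close>

lemma infinite_invasion_cluster:
  assumes d: "\<And>v. 0 < d v"
  shows "infinite (invasion_cluster (gw_tree d) U)"
proof
  assume fin: "finite (invasion_cluster (gw_tree d) U)"
  let ?I = "invasion_step (gw_tree d) U"
  have "card (?I n) = Suc n" for n
  proof (induction n)
    case (Suc n)
    have fs: "finite_subtree d (?I n)" by (rule finite_subtree_invasion_step) (rule d)
    have "(ARG_MIN U v. v \<in> outer_boundary (gw_tree d) (?I n)) \<notin> ?I n"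
      using arg_min_outer_boundary(1)[OF fs d, where U=U] by (simp add: outer_boundary_def)
    with Suc fs show ?case by (simp add: finite_subtree_def)
  qed simp
  moreover have "card (?I n) \<le> card (invasion_cluster (gw_tree d) U)" for n
    by (rule card_mono[OF fin]) (auto simp: invasion_cluster_def)
  ultimately show False by (metis not_less_eq_eq order_refl)
qed

text \<open>Whether \<open>v\<close> is invaded is decided before the invasion can look below \<open>v\<close>.\<close>

lemma invasion_cluster_cong:
  assumes d: "\<And>u. 0 < d u" and d': "\<And>u. 0 < d' u"
    and eq: "\<And>u. \<not> prefix (v @ [i]) u \<Longrightarrow> d u = d' u"
      "\<And>u. \<not> prefix (v @ [i]) u \<Longrightarrow> U u = U' u"
  shows "v \<in> invasion_cluster (gw_tree d) U \<longleftrightarrow> v \<in> invasion_cluster (gw_tree d') U'"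
proof -
  let ?I = "invasion_step (gw_tree d) U" and ?I' = "invasion_step (gw_tree d') U'"
  \<comment> \<open>The two runs coincide until \<open>v\<close> enters both. Before that no invaded
    vertex extends \<open>v\<close>, so the boundary may contain \<open>v\<close> itself but nothing
    that extends \<open>v @ [i]\<close>, and both runs compare the same weights.\<close>
  have "?I n = ?I' n \<or> v \<in> ?I n \<and> v \<in> ?I' n" for n
  proof (induction n)
    case (Suc n)
    show ?case
    proof (cases "v \<in> ?I n \<and> v \<in> ?I' n")
      case False
      with Suc have same: "?I n = ?I' n" and v: "v \<notin> ?I n" by auto
      have fs: "finite_subtree d (?I n)" "finite_subtree d' (?I n)"
        using finite_subtree_invasion_step[of d U n] finite_subtree_invasion_step[of d' U' n] d d' same
        by auto
      have off: "\<not> prefix v u" if "u \<in> ?I n" for u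
        using that v finite_subtree_append[OF fs(1)] by (auto simp: prefix_def)
      have off': "\<not> prefix (v @ [i]) u" if "u \<in> ?I n" for u
        using off[OF that] by (meson append_prefixD)
      have ob: "outer_boundary (gw_tree d) (?I n) = outer_boundary (gw_tree d') (?I' n)" (is "?B = _")
        using eq(1)[OF off'] unfolding same[symmetric] outer_boundary_finite_subtree[OF fs(1)]
          outer_boundary_finite_subtree[OF fs(2)] by auto
      have "\<not> prefix (v @ [i]) u" if "u \<in> ?B" for u
      proof -
        obtain w k where "u = w @ [k]" "w \<in> ?I n"
          using \<open>u \<in> ?B\<close> unfolding outer_boundary_finite_subtree[OF fs(1)] by auto
        then show ?thesis using off[of w] off'[of w] by (auto simp: prefix_snoc)
      qed
      then have "U u = U' u" if "u \<in> ?B" for u using eq(2) that by blast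
      then have "is_arg_min U (\<lambda>u. u \<in> ?B) = is_arg_min U' (\<lambda>u. u \<in> ?B)"
        by (auto simp: is_arg_min_def fun_eq_iff)
      then show ?thesis using same ob by (simp add: arg_min_def)
    qed auto
  qed simp
  then show ?thesis unfolding invasion_cluster_def by blast
qed

section \<open>Paths of low weight and their effect on the invasion\<close>

lemma outer_boundary_on_long_paths:
  assumes F: "finite_subtree d F" and v: "v \<in> F"
    and long: "\<And>n. \<exists>w. n \<le> length w \<and> v @ w \<in> gw_tree d \<and>
      (\<forall>k. 0 < k \<longrightarrow> k \<le> length w \<longrightarrow> P (v @ take k w))"
  shows "\<exists>x\<in>outer_boundary (gw_tree d) F. P x"
proof -
  \<comment> \<open>A path reaching beyond every height in \<open>F\<close> must exit
    \<open>F\<close>. The exit happens strictly after \<open>v\<close>, so \<open>P\<close> is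
    required only for \<open>0 < k\<close>; the weight of \<open>v\<close> itself may be
    large.\<close>
  have "finite (length ` F)" using F by (simp add: finite_subtree_def)
  then obtain N where N: "\<And>u. u \<in> F \<Longrightarrow> length u < N"
    by (metis finite_nat_set_iff_bounded imageI)
  obtain w where w: "N \<le> length w" "v @ w \<in> gw_tree d"
    "\<And>k. 0 < k \<Longrightarrow> k \<le> length w \<Longrightarrow> P (v @ take k w)" using long by blast
  have "v @ w \<notin> F" using N[of "v @ w"] w(1) by auto
  then show ?thesis using outer_boundary_on_path[OF F v w(2)] w(3) by metis
qed

text \<open>Percolation at level \<open>a\<close> down to depth \<open>n\<close>, the root's own
  weight included. Recursing on the first generation yields the branching recursion
  \<open>open_prob_Suc\<close> directly; \<open>open_path_iff\<close> recovers the actual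
  path.\<close>

primrec open_path :: "real \<Rightarrow> nat \<Rightarrow> (vertex \<Rightarrow> nat \<times> real) \<Rightarrow> bool" where
  "open_path a 0 \<omega> \<longleftrightarrow> snd (\<omega> []) \<le> a"
| "open_path a (Suc n) \<omega> \<longleftrightarrow>
     snd (\<omega> []) \<le> a \<and> (\<exists>i<fst (\<omega> []). open_path a n (\<lambda>w. \<omega> (i # w)))"

lemma open_path_iff:
  "open_path a n \<omega> \<longleftrightarrow>
     (\<exists>w. length w = n \<and> w \<in> gw_tree (\<lambda>u. fst (\<omega> u)) \<and> (\<forall>k\<le>n. snd (\<omega> (take k w)) \<le> a))"
proof (induction n arbitrary: \<omega>)
  case 0
  then show ?case by (auto simp: gw_tree.root)
next
  case (Suc n)
  have all: "(\<forall>k\<le>Suc n. snd (\<omega> (take k (i # w))) \<le> a) \<longleftrightarrow>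
      snd (\<omega> []) \<le> a \<and> (\<forall>k\<le>n. snd (\<omega> (i # take k w)) \<le> a)" (is "?l \<longleftrightarrow> ?r") for i w
  proof
    assume l: ?l
    show ?r
    proof (intro conjI allI impI)
      show "snd (\<omega> []) \<le> a" using l[rule_format, of 0] by simp
      show "snd (\<omega> (i # take k w)) \<le> a" if "k \<le> n" for k using l[rule_format, of "Suc k"] that by simp
    qed
  next
    assume ?r
    then show ?l by (auto simp: take_Cons split: nat.split)
  qed
  show ?case
    unfolding open_path.simps Suc.IH
  proof (intro iffI; elim conjE exE)
    fix i w
    assume "snd (\<omega> []) \<le> a" "i < fst (\<omega> [])" "length w = n" "w \<in> gw_tree (\<lambda>u. fst (\<omega> (i # u)))"
      "\<forall>k\<le>n. snd (\<omega> (i # take k w)) \<le> a"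
    then show "\<exists>w. length w = Suc n \<and> w \<in> gw_tree (\<lambda>u. fst (\<omega> u)) \<and>
        (\<forall>k\<le>Suc n. snd (\<omega> (take k w)) \<le> a)"
      by (intro exI[of _ "i # w"]) (simp add: gw_tree_Cons_iff all del: take_Suc_Cons)
  next
    fix w
    assume w: "length w = Suc n" "w \<in> gw_tree (\<lambda>u. fst (\<omega> u))" "\<forall>k\<le>Suc n. snd (\<omega> (take k w)) \<le> a"
    then obtain i u where iu: "w = i # u" by (cases w) auto
    show "snd (\<omega> []) \<le> a \<and> (\<exists>i<fst (\<omega> []). \<exists>w. length w = n \<and>
        w \<in> gw_tree (\<lambda>u. fst (\<omega> (i # u))) \<and> (\<forall>k\<le>n. snd (\<omega> (i # take k w)) \<le> a))"
      using w unfolding iu gw_tree_Cons_iff all by (auto intro!: exI[of _ i] exI[of _ u])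
  qed
qed

lemma open_path_antimono: "open_path a n \<omega> \<Longrightarrow> m \<le> n \<Longrightarrow> open_path a m \<omega>"
proof -
  assume "open_path a n \<omega>" and m: "m \<le> n"
  then obtain w where w: "length w = n" "w \<in> gw_tree (\<lambda>u. fst (\<omega> u))"
    "\<And>k. k \<le> n \<Longrightarrow> snd (\<omega> (take k w)) \<le> a"
    unfolding open_path_iff by blast
  have "take m w \<in> gw_tree (\<lambda>u. fst (\<omega> u))"
    using w(2) gw_tree_append_iff[of "take m w" "drop m w"] by simp
  moreover have "length (take m w) = m" using w(1) m by simp
  moreover have "\<forall>k\<le>m. snd (\<omega> (take k (take m w))) \<le> a" using w(3) m by (auto simp: min_def)
  ultimately show "open_path a m \<omega>" unfolding open_path_iff by blast
qed

text \<open>Once one of the two vertices is invaded, the low paths below its first child always put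
  a vertex of weight at most \<open>a\<close> into the boundary. The minimality rule then forbids
  any later choice of weight above \<open>a\<close>, so neither vertex can be invaded after the
  other.\<close>

lemma invaded_above_percolation_unique:
  fixes U :: "vertex \<Rightarrow> real"
  assumes d: "\<And>u. 0 < d u"
    and v: "v \<in> invasion_cluster (gw_tree d) U" "a < U v" "v \<noteq> []"
      "\<And>n. open_path a n (\<lambda>w. (d (v @ 0 # w), U (v @ 0 # w)))"
    and v': "v' \<in> invasion_cluster (gw_tree d) U" "a < U v'" "v' \<noteq> []"
      "\<And>n. open_path a n (\<lambda>w. (d (v' @ 0 # w), U (v' @ 0 # w)))"
  shows "v = v'"
proof -
  let ?I = "invasion_step (gw_tree d) U"
  have not_below: False
    if u: "u \<in> ?I n" and perc: "\<And>n. open_path a n (\<lambda>w. (d (u @ 0 # w), U (u @ 0 # w)))"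
      and u': "a < U u'" "\<And>x. x \<in> outer_boundary (gw_tree d) (?I n) \<Longrightarrow> U u' \<le> U x" for u u' n
  proof -
    have fs: "finite_subtree d (?I n)" by (rule finite_subtree_invasion_step) (rule d)
    have "\<exists>w. n \<le> length w \<and> u @ w \<in> gw_tree d \<and>
      (\<forall>k. 0 < k \<longrightarrow> k \<le> length w \<longrightarrow> U (u @ take k w) \<le> a)" for n
    proof -
      obtain w where w: "length w = n" "w \<in> gw_tree (\<lambda>x. d (u @ 0 # x))"
        "\<And>k. k \<le> n \<Longrightarrow> U (u @ 0 # take k w) \<le> a"
        using perc[of n] unfolding open_path_iff by auto
      have "u @ 0 # w \<in> gw_tree d"
        using w(2) fs u d by (auto simp: gw_tree_append_iff gw_tree_Cons_iff finite_subtree_def)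
      moreover have "U (u @ take k (0 # w)) \<le> a" if "0 < k" "k \<le> length (0 # w)" for k
        using that w by (cases k) auto
      ultimately show ?thesis using w(1) by (intro exI[of _ "0 # w"]) auto
    qed
    from outer_boundary_on_long_paths[OF fs u this] u' show False by fastforce
  qed
  obtain n where n: "v \<in> outer_boundary (gw_tree d) (?I n)" "v \<in> ?I (Suc n)"
    "\<And>w. w \<in> outer_boundary (gw_tree d) (?I n) \<Longrightarrow> U v \<le> U w"
    using invasion_clusterE[OF d v(1,3)] by metis
  obtain n' where n': "v' \<in> outer_boundary (gw_tree d) (?I n')" "v' \<in> ?I (Suc n')"
    "\<And>w. w \<in> outer_boundary (gw_tree d) (?I n') \<Longrightarrow> U v' \<le> U w"
    using invasion_clusterE[OF d v'(1,3)] by metis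
  show ?thesis
  proof (cases n n' rule: linorder_cases)
    case less
    then have "v \<in> ?I n'" using n(2) invasion_step_mono[of "Suc n" n'] by auto
    then show ?thesis using not_below[OF _ v(4) v'(2) n'(3)] by blast
  next
    case greater
    then have "v' \<in> ?I n" using n'(2) invasion_step_mono[of "Suc n'" n] by auto
    then show ?thesis using not_below[OF _ v'(4) v(2) n(3)] by blast
  \<comment> \<open>If both enter at the same step they agree, since a step adds only one
    vertex.\<close>
  next
    case equal
    then show ?thesis using n(1,2) n'(1,2) by (auto simp: outer_boundary_def)
  qed
qed

section \<open>Rays as increasing sequences of prefixes, and their existence\<close>

lemma rays_Suc:
  assumes "\<gamma> \<in> rays A"
  shows "\<exists>i. \<gamma> (Suc n) = \<gamma> n @ [i]"
proof (induction n)
  case 0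
  have "adj (\<gamma> 0) (\<gamma> (Suc 0))" "\<gamma> 0 = []" using assms unfolding rays_def by blast+
  then show ?case by (auto simp: adj_def)
next
  case (Suc n)
  \<comment> \<open>By induction the parent of \<open>\<gamma> (Suc n)\<close> is
    \<open>\<gamma> n\<close>, which non-backtracking forbids as the next vertex; only a child
    remains.\<close>
  have "adj (\<gamma> (Suc n)) (\<gamma> (Suc (Suc n)))" "\<gamma> (Suc (Suc n)) \<noteq> \<gamma> n"
    using assms by (auto simp: rays_def)
  with Suc show ?case by (auto simp: adj_def)
qed

lemma length_rays: "\<gamma> \<in> rays A \<Longrightarrow> length (\<gamma> n) = n"
proof (induction n)
  case 0
  then show ?case by (simp add: rays_def)
next
  case (Suc n)
  then show ?case using rays_Suc[of \<gamma> A n] by auto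
qed

lemma rays_add: "\<gamma> \<in> rays A \<Longrightarrow> \<exists>w. length w = k \<and> \<gamma> (n + k) = \<gamma> n @ w"
proof (induction k)
  case (Suc k)
  then obtain w where "length w = k" "\<gamma> (n + k) = \<gamma> n @ w" by blast
  moreover obtain i where "\<gamma> (Suc (n + k)) = \<gamma> (n + k) @ [i]" using rays_Suc[OF Suc.prems] by blast
  ultimately show ?case by (intro exI[of _ "w @ [i]"]) simp
qed simp

lemma take_rays: "\<gamma> \<in> rays A \<Longrightarrow> m \<le> n \<Longrightarrow> take m (\<gamma> n) = \<gamma> m"
  using rays_add[of \<gamma> A "n - m" m] length_rays[of \<gamma> A m] by auto

lemma raysI:
  assumes "\<gamma> 0 = []" "\<And>n. \<gamma> n \<in> A" "\<And>n. \<exists>i. \<gamma> (Suc n) = \<gamma> n @ [i]"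
  shows "\<gamma> \<in> rays A"
proof -
  have "length (\<gamma> (Suc (Suc n))) = length (\<gamma> n) + 2" for n
    using assms(3)[of n] assms(3)[of "Suc n"] by auto
  then have "\<gamma> (Suc (Suc n)) \<noteq> \<gamma> n" for n by (metis add_cancel_right_right zero_neq_numeral)
  with assms show ?thesis by (auto simp: rays_def adj_def)
qed

lemma rays_mem: "\<gamma> \<in> rays A \<Longrightarrow> \<gamma> n \<in> A"
  by (simp add: rays_def)

text \<open>Koenig's lemma: a vertex with infinitely many extensions in \<open>A\<close> has
  finitely many children in the tree, so one of them again has infinitely many.\<close>

lemma ex_ray:
  assumes inf: "infinite A" and sub: "A \<subseteq> gw_tree d" and pre: "\<And>v w. v @ w \<in> A \<Longrightarrow> v \<in> A"
  shows "\<exists>\<gamma>. \<gamma> \<in> rays A"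
proof -
  \<comment> \<open>The second conjunct forces the dependent choice to start at the root.\<close>
  define P where "P n v \<longleftrightarrow> infinite {w. v @ w \<in> A} \<and> (n = 0 \<longrightarrow> v = [])" for n :: nat and v
  have "\<exists>f. \<forall>n. P n (f n) \<and> (\<exists>i. f (Suc n) = f n @ [i])"
  proof (rule dependent_nat_choice)
    show "\<exists>v. P 0 v" using inf by (auto simp: P_def)
    fix v n assume v: "P n v"
    have "\<exists>i<d v. infinite {w. (v @ [i]) @ w \<in> A}"
    proof (rule ccontr)
      assume "\<not> (\<exists>i<d v. infinite {w. (v @ [i]) @ w \<in> A})"
      then have fin: "finite (insert [] (\<Union>i<d v. (#) i ` {w. (v @ [i]) @ w \<in> A}))" by auto
      have "w \<in> insert [] (\<Union>i<d v. (#) i ` {w. (v @ [i]) @ w \<in> A})" if "v @ w \<in> A" for w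
      proof (cases w)
        case (Cons i u)
        with that have "(v @ [i]) @ u \<in> A" by simp
        moreover have "i < d v" using pre[OF calculation] sub by (auto simp: gw_tree_snoc_iff)
        ultimately show ?thesis using Cons by auto
      qed simp
      then have "{w. v @ w \<in> A} \<subseteq> insert [] (\<Union>i<d v. (#) i ` {w. (v @ [i]) @ w \<in> A})" by blast
      then have "finite {w. v @ w \<in> A}" using fin by (rule finite_subset)
      with v show False by (simp add: P_def)
    qed
    then show "\<exists>v'. P (Suc n) v' \<and> (\<exists>i. v' = v @ [i])" unfolding P_def by blast
  qed
  then obtain f where f: "\<And>n. P n (f n)" "\<And>n. \<exists>i. f (Suc n) = f n @ [i]" by blast
  have "f n \<in> A" for n
  proof -
    have "{w. f n @ w \<in> A} \<noteq> {}" using f(1)[of n] unfolding P_def by (metis finite.emptyI)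
    then show ?thesis using pre by blast
  qed
  moreover have "f 0 = []" using f(1)[of 0] by (simp add: P_def)
  ultimately show ?thesis using raysI f(2) by metis
qed

text \<open>
  If the cluster contained two rays, the one with the larger maximal weight beyond the branch
  point could not be completed: the other one always offers a cheaper boundary vertex.
\<close>

lemma unique_ray_invasion_cluster:
  fixes U :: "vertex \<Rightarrow> real"
  assumes d: "\<And>u. 0 < d u"
    and inj: "inj U"
    and above: "\<And>a. q < a \<Longrightarrow> finite {v \<in> invasion_cluster (gw_tree d) U. a < U v}"
    and crit: "\<And>v. \<exists>n. \<not> open_path q n (\<lambda>w. (d (v @ w), U (v @ w)))"
  shows "\<exists>!\<gamma>. \<gamma> \<in> rays (invasion_cluster (gw_tree d) U)"
proof -
  let ?I = "invasion_step (gw_tree d) U" and ?C = "invasion_cluster (gw_tree d) U"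
  \<comment> \<open>Absence of critical paths yields a weight above \<open>q\<close> at some height
    from \<open>m\<close> on. With \<open>a\<close> halfway between \<open>q\<close> and that
    weight, only finitely many weights of the ray exceed \<open>a\<close>, so the supremum from
    \<open>m\<close> on is a maximum over a finite nonempty set.\<close>
  have max: "\<exists>j\<ge>m. \<forall>l\<ge>m. U (\<gamma> l) \<le> U (\<gamma> j)" if \<gamma>: "\<gamma> \<in> rays ?C" for \<gamma> m
  proof -
    obtain n where n: "\<not> open_path q n (\<lambda>w. (d (\<gamma> m @ w), U (\<gamma> m @ w)))" using crit by blast
    obtain w where w: "length w = n" "\<gamma> (m + n) = \<gamma> m @ w" using rays_add[OF \<gamma>] by blast
    have "\<gamma> m @ w \<in> gw_tree d"
      using rays_mem[OF \<gamma>, of "m + n"] invasion_cluster_subset[of d U, OF d] w(2) by auto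
    then have "w \<in> gw_tree (\<lambda>u. d (\<gamma> m @ u))" by (simp add: gw_tree_append_iff)
    with n w(1) obtain k where k: "k \<le> n" "q < U (\<gamma> m @ take k w)"
      unfolding open_path_iff by (auto simp: not_le)
    moreover have "\<gamma> m @ take k w = \<gamma> (m + k)"
      using take_rays[OF \<gamma>, of "m + k" "m + n"] w k(1) length_rays[OF \<gamma>, of m] by simp
    ultimately have qk: "q < U (\<gamma> (m + k))" by simp
    define a where "a = (q + U (\<gamma> (m + k))) / 2"
    have a: "q < a" "a < U (\<gamma> (m + k))" using qk by (auto simp: a_def)
    let ?J = "{j. m \<le> j \<and> a < U (\<gamma> j)}"
    have "length ` {v \<in> ?C. a < U v} \<supseteq> ?J"
      using rays_mem[OF \<gamma>] length_rays[OF \<gamma>] by (force simp: image_iff)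
    then have "finite ?J" using above[OF a(1)] finite_surj by blast
    moreover have "m + k \<in> ?J" using a by simp
    ultimately have "finite ((\<lambda>l. U (\<gamma> l)) ` ?J)" "(\<lambda>l. U (\<gamma> l)) ` ?J \<noteq> {}" by blast+
    then have "Max ((\<lambda>l. U (\<gamma> l)) ` ?J) \<in> (\<lambda>l. U (\<gamma> l)) ` ?J" by (rule Max_in)
    then obtain j where j: "j \<in> ?J" "U (\<gamma> j) = Max ((\<lambda>l. U (\<gamma> l)) ` ?J)" by force
    then have j: "j \<in> ?J" "\<And>l. l \<in> ?J \<Longrightarrow> U (\<gamma> l) \<le> U (\<gamma> j)"
      using \<open>finite ?J\<close> by (auto intro: Max_ge)
    have "U (\<gamma> l) \<le> U (\<gamma> j)" if "m \<le> l" for l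
      using j(2)[of l] j(1) that by (cases "a < U (\<gamma> l)") auto
    with j(1) show ?thesis by auto
  qed
  \<comment> \<open>When \<open>\<gamma> j\<close> is chosen, its ancestor \<open>\<gamma> m\<close>
    is already invaded. As \<open>\<gamma>'\<close> continues from there through smaller weights
    only, it exits the invaded set at a cheaper boundary vertex.\<close>
  have no: False
    if \<gamma>: "\<gamma> \<in> rays ?C" "\<gamma>' \<in> rays ?C" and eq: "\<gamma> m = \<gamma>' m" and j: "m < j"
      and less: "\<And>l. m < l \<Longrightarrow> U (\<gamma>' l) < U (\<gamma> j)" for \<gamma> \<gamma>' m j
  proof -
    have "\<gamma> j \<noteq> []" using length_rays[OF \<gamma>(1), of j] j by auto
    then obtain n where n: "\<gamma> j \<in> outer_boundary (gw_tree d) (?I n)"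
      "\<And>w. w \<in> outer_boundary (gw_tree d) (?I n) \<Longrightarrow> U (\<gamma> j) \<le> U w"
      using invasion_clusterE[OF d rays_mem[OF \<gamma>(1)]] by metis
    have fs: "finite_subtree d (?I n)" by (rule finite_subtree_invasion_step) (rule d)
    obtain u i where u: "u \<in> ?I n" "\<gamma> j = u @ [i]"
      using n(1) unfolding outer_boundary_finite_subtree[OF fs] by blast
    have "take m u = \<gamma> m" using take_rays[OF \<gamma>(1), of m j] j u(2) length_rays[OF \<gamma>(1), of j] by auto
    then have "\<gamma>' m \<in> ?I n"
      using finite_subtree_append[OF fs, of "take m u" "drop m u"] u(1) eq
      by (metis append_take_drop_id)
    moreover have "\<exists>w. n \<le> length w \<and> \<gamma>' m @ w \<in> gw_tree d \<and>
      (\<forall>k. 0 < k \<longrightarrow> k \<le> length w \<longrightarrow> U (\<gamma>' m @ take k w) < U (\<gamma> j))" for n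
    proof -
      obtain w where w: "length w = n" "\<gamma>' (m + n) = \<gamma>' m @ w" using rays_add[OF \<gamma>(2)] by blast
      have "\<gamma>' m @ w \<in> gw_tree d"
        using rays_mem[OF \<gamma>(2), of "m + n"] invasion_cluster_subset[of d U, OF d] w(2) by auto
      moreover have "\<gamma>' m @ take k w = \<gamma>' (m + k)" if "k \<le> n" for k
        using take_rays[OF \<gamma>(2), of "m + k" "m + n"] w that length_rays[OF \<gamma>(2), of m] by simp
      ultimately show ?thesis using less w(1) by (intro exI[of _ w]) auto
    qed
    ultimately have "\<exists>x\<in>outer_boundary (gw_tree d) (?I n). U x < U (\<gamma> j)"
      by (rule outer_boundary_on_long_paths[OF fs])
    with n(2) show False by fastforce
  qed
  have uniq: "\<gamma> = \<gamma>'" if \<gamma>: "\<gamma> \<in> rays ?C" "\<gamma>' \<in> rays ?C" for \<gamma> \<gamma>'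
  proof (rule ccontr)
    assume "\<gamma> \<noteq> \<gamma>'"
    then obtain n where n: "\<gamma> n \<noteq> \<gamma>' n" by auto
    define s where "s = (LEAST n. \<gamma> n \<noteq> \<gamma>' n)"
    have s: "\<gamma> s \<noteq> \<gamma>' s" unfolding s_def by (rule LeastI) (rule n)
    have "\<gamma> 0 = \<gamma>' 0" using \<gamma> by (simp add: rays_def)
    with s obtain m where m: "s = Suc m" by (cases s) auto
    have eq: "\<gamma> m = \<gamma>' m" using not_less_Least[of m "\<lambda>n. \<gamma> n \<noteq> \<gamma>' n"] m s_def by auto
    have diff: "\<gamma> j \<noteq> \<gamma>' l" if "m < j" "m < l" for j l
      using s take_rays[OF \<gamma>(1), of s j] take_rays[OF \<gamma>(2), of s l] that m by auto
    obtain j where j: "m < j" "\<And>l. m < l \<Longrightarrow> U (\<gamma> l) \<le> U (\<gamma> j)"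
      using max[OF \<gamma>(1), of "Suc m"] by (auto simp: Suc_le_eq)
    obtain l where l: "m < l" "\<And>k. m < k \<Longrightarrow> U (\<gamma>' k) \<le> U (\<gamma>' l)"
      using max[OF \<gamma>(2), of "Suc m"] by (auto simp: Suc_le_eq)
    \<comment> \<open>The rays never meet again after \<open>m\<close>, so the two maxima sit at
      different vertices; distinct weights make one of them strictly larger.\<close>
    have "U (\<gamma> j) \<noteq> U (\<gamma>' l)" using inj diff[OF j(1) l(1)] by (auto dest: injD)
    then consider "U (\<gamma> j) < U (\<gamma>' l)" | "U (\<gamma>' l) < U (\<gamma> j)" by linarith
    then show False
    proof cases
      case 1
      show False by (rule no[OF \<gamma>(2,1) eq[symmetric] l(1)]) (use j(2) 1 in force)
    next
      case 2
      show False by (rule no[OF \<gamma> eq j(1)]) (use l(2) 2 in force)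
    qed
  qed
  have "\<exists>\<gamma>. \<gamma> \<in> rays ?C"
    by (rule ex_ray[OF infinite_invasion_cluster invasion_cluster_subset])
       (use d invasion_cluster_append[of d _ _ U] in auto)
  with uniq show ?thesis by blast
qed

section \<open>Product measures\<close>

lemma indep_vars_PiM_coordinates:
  assumes "I \<noteq> {}" and "\<And>i. i \<in> I \<Longrightarrow> prob_space (M i)"
  shows "prob_space.indep_vars (PiM I M) M (\<lambda>i \<omega>. \<omega> i) I"
proof -
  interpret prob_space "PiM I M" by (rule prob_space_PiM) (rule assms)
  have "distr (PiM I M) (PiM I M) (\<lambda>x. \<lambda>i\<in>I. x i) = distr (PiM I M) (PiM I M) (\<lambda>x. x)"
    by (rule distr_cong) (auto simp: space_PiM PiE_def extensional_restrict)
  also have "\<dots> = PiM I (\<lambda>i. distr (PiM I M) (M i) (\<lambda>\<omega>. \<omega> i))"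
    by (simp add: distr_id) (rule PiM_cong, simp_all add: distr_PiM_component assms)
  finally show ?thesis
    by (subst indep_vars_iff_distr_eq_PiM'[OF assms(1)]) auto
qed

text \<open>Separates degrees from weights: zipping two independent families gives the family of
  pairs. It suffices to check cylinders, where Fubini reduces to slices and independence of the
  coordinates turns the integral of a product into a product of integrals.\<close>

lemma distr_PiM_pair:
  assumes I: "I \<noteq> {}" and A: "\<And>i. i \<in> I \<Longrightarrow> prob_space (A i)" and B: "\<And>i. i \<in> I \<Longrightarrow> prob_space (B i)"
  shows "distr (PiM I A \<Otimes>\<^sub>M PiM I B) (PiM I (\<lambda>i. A i \<Otimes>\<^sub>M B i)) (\<lambda>(x, y). \<lambda>i\<in>I. (x i, y i)) =
    PiM I (\<lambda>i. A i \<Otimes>\<^sub>M B i)"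
    (is "distr ?D ?P ?z = _")
proof (rule measure_eqI_PiM_infinite[symmetric, OF refl])
  have AB: "prob_space (A i \<Otimes>\<^sub>M B i)" if "i \<in> I" for i
    by (rule prob_space_pair) (use that A B in auto)
  interpret PA: prob_space "PiM I A" by (rule prob_space_PiM) (rule A)
  interpret PB: prob_space "PiM I B" by (rule prob_space_PiM) (rule B)
  interpret P: prob_space ?P by (rule prob_space_PiM) (rule AB)
  show "finite_measure ?P" by unfold_locales
  have z: "?z \<in> measurable ?D ?P" by measurable
  fix E J assume J: "finite J" "J \<subseteq> I" and E: "\<And>i. i \<in> J \<Longrightarrow> E i \<in> sets (A i \<Otimes>\<^sub>M B i)"
  let ?X = "prod_emb I (\<lambda>i. A i \<Otimes>\<^sub>M B i) J (Pi\<^sub>E J E)"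
  have X: "?X \<in> sets ?P" using J E by (intro sets_PiM_I) auto
  let ?g = "\<lambda>j a. emeasure (B j) (Pair a -` E j)"
  have g: "?g j \<in> borel_measurable (A j)" if "j \<in> J" for j
  proof -
    interpret Bj: prob_space "B j" using B J that by auto
    show ?thesis by (rule Bj.measurable_emeasure_Pair) (use E that in auto)
  qed
  \<comment> \<open>A slice of a cylinder is again a cylinder, built from the slices of the
    \<open>E j\<close>.\<close>
  have sl: "Pair x -` (?z -` ?X \<inter> space ?D) = prod_emb I B J (\<Pi>\<^sub>E j\<in>J. Pair (x j) -` E j)"
    if "x \<in> space (PiM I A)" for x
  proof -
    have "E j \<subseteq> space (A j) \<times> space (B j)" if "j \<in> J" for j
      using sets.sets_into_space[OF E[OF that]] by (simp add: space_pair_measure)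
    with that J(2) show ?thesis
      by (auto simp: prod_emb_def space_PiM space_pair_measure PiE_iff subset_eq)
  qed
  have "emeasure (distr ?D ?P ?z) ?X = emeasure ?D (?z -` ?X \<inter> space ?D)"
    using X z by (rule emeasure_distr[rotated])
  also have "\<dots> = (\<integral>\<^sup>+x. emeasure (PiM I B) (Pair x -` (?z -` ?X \<inter> space ?D)) \<partial>PiM I A)"
    by (rule PB.emeasure_pair_measure_alt) (rule measurable_sets[OF z X])
  also have "\<dots> = (\<integral>\<^sup>+x. emeasure (PiM I B) (prod_emb I B J (\<Pi>\<^sub>E j\<in>J. Pair (x j) -` E j)) \<partial>PiM I A)"
    by (rule nn_integral_cong) (simp only: sl)
  also have "\<dots> = (\<integral>\<^sup>+x. (\<Prod>j\<in>J. ?g j (x j)) \<partial>PiM I A)"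
    by (rule nn_integral_cong, rule emeasure_PiM_emb) (use J E B in \<open>auto intro: sets_Pair1\<close>)
  also have "\<dots> = (\<Prod>j\<in>J. \<integral>\<^sup>+x. ?g j (x j) \<partial>PiM I A)"
  proof (rule PA.indep_vars_nn_integral[OF J(1)])
    have "PA.indep_vars A (\<lambda>i \<omega>. \<omega> i) J"
      by (rule PA.indep_vars_subset[OF indep_vars_PiM_coordinates[OF I] J(2)]) (rule A)
    then show "PA.indep_vars (\<lambda>_. borel) (\<lambda>j x. ?g j (x j)) J"
      by (rule PA.indep_vars_compose2) (rule g)
  qed simp
  also have "\<dots> = (\<Prod>j\<in>J. \<integral>\<^sup>+a. ?g j a \<partial>A j)"
  proof (rule prod.cong[OF refl])
    fix j assume j: "j \<in> J"
    then have "j \<in> I" using J by auto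
    have "(\<integral>\<^sup>+x. ?g j (x j) \<partial>PiM I A) = (\<integral>\<^sup>+a. ?g j a \<partial>distr (PiM I A) (A j) (\<lambda>x. x j))"
      by (rule nn_integral_distr[symmetric]) (use g[OF j] \<open>j \<in> I\<close> in auto)
    then show "(\<integral>\<^sup>+x. ?g j (x j) \<partial>PiM I A) = (\<integral>\<^sup>+a. ?g j a \<partial>A j)"
      using distr_PiM_component[of I A j, OF A \<open>j \<in> I\<close>] by simp
  qed
  also have "\<dots> = (\<Prod>j\<in>J. emeasure (A j \<Otimes>\<^sub>M B j) (E j))"
  proof (rule prod.cong[OF refl])
    fix j assume j: "j \<in> J"
    interpret Bj: prob_space "B j" using B J j by auto
    show "(\<integral>\<^sup>+a. ?g j a \<partial>A j) = emeasure (A j \<Otimes>\<^sub>M B j) (E j)"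
      by (rule Bj.emeasure_pair_measure_alt[symmetric]) (rule E[OF j])
  qed
  also have "\<dots> = emeasure ?P ?X"
    by (rule emeasure_PiM_emb[symmetric]) (use J E AB in auto)
  finally show "emeasure ?P ?X = emeasure (distr ?D ?P ?z) ?X" by simp
qed simp

text \<open>Fubini in the form needed to pass from the annealed law of labelled trees to almost
  every fixed tree with random weights.\<close>

lemma AE_PiM_pair:
  assumes A: "\<And>i. prob_space (A i)" and B: "\<And>i. prob_space (B i)"
    and P: "AE \<omega> in PiM UNIV (\<lambda>i. A i \<Otimes>\<^sub>M B i). P \<omega>"
  shows "AE x in PiM UNIV A. AE y in PiM UNIV B. P (\<lambda>i. (x i, y i))"
proof -
  interpret PA: prob_space "PiM UNIV A" by (rule prob_space_PiM) (rule A)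
  interpret PB: prob_space "PiM UNIV B" by (rule prob_space_PiM) (rule B)
  interpret pair_prob_space "PiM UNIV A" "PiM UNIV B" ..
  let ?D = "PiM UNIV A \<Otimes>\<^sub>M PiM UNIV B" and ?P = "PiM UNIV (\<lambda>i. A i \<Otimes>\<^sub>M B i)"
  let ?z = "\<lambda>(x, y). \<lambda>i\<in>UNIV. (x i, y i)"
  have z: "?z \<in> measurable ?D ?P" by measurable
  have "AE \<omega> in distr ?D ?P ?z. P \<omega>"
    using distr_PiM_pair[of UNIV A B, OF UNIV_not_empty A B] P by (simp only:)
  from AE_distrD[OF z this]
  have "AE z in PiM UNIV A \<Otimes>\<^sub>M PiM UNIV B. P (\<lambda>i. (fst z i, snd z i))"
    by eventually_elim (auto simp: split_beta restrict_UNIV)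
  from AE_pair[OF this] show ?thesis by simp
qed

text \<open>The degree marginal of the joint law is the product of the degree laws, so statements
  about degrees alone lift back to the joint space.\<close>

lemma AE_PiM_fst:
  assumes A: "\<And>i. prob_space (A i)" and B: "\<And>i. prob_space (B i)"
    and P: "AE x in PiM UNIV A. P x"
  shows "AE \<omega> in PiM UNIV (\<lambda>i. A i \<Otimes>\<^sub>M B i). P (\<lambda>i. fst (\<omega> i))"
proof -
  interpret PA: prob_space "PiM UNIV A" by (rule prob_space_PiM) (rule A)
  interpret PB: prob_space "PiM UNIV B" by (rule prob_space_PiM) (rule B)
  let ?P = "PiM UNIV (\<lambda>i. A i \<Otimes>\<^sub>M B i)" and ?f = "\<lambda>\<omega> i. fst (\<omega> i)"
  have f: "?f \<in> measurable ?P (PiM UNIV A)" by (rule measurable_PiM_single') (auto simp: space_PiM space_pair_measure PiE_iff mem_Times_iff)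
  let ?D = "PiM UNIV A \<Otimes>\<^sub>M PiM UNIV B" and ?z = "\<lambda>(x, y). \<lambda>i\<in>UNIV. (x i, y i)"
  have "distr ?P (PiM UNIV A) ?f = distr (distr ?D ?P ?z) (PiM UNIV A) ?f"
    using distr_PiM_pair[of UNIV A B, OF UNIV_not_empty A B] by (simp only:)
  also have "\<dots> = distr ?D (PiM UNIV A) (?f \<circ> ?z)"
    by (rule distr_distr[OF f]) measurable
  also have "?f \<circ> ?z = fst" by (auto simp: fun_eq_iff)
  also have "distr ?D (PiM UNIV A) fst = PiM UNIV A"
    by (rule PB.distr_pair_fst)
  finally have eq: "distr ?P (PiM UNIV A) ?f = PiM UNIV A" .
  have "AE x in distr ?P (PiM UNIV A) ?f. P x" unfolding eq by (rule P)
  from AE_distrD[OF f this] show ?thesis .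
qed

section \<open>Percolation on Galton--Watson trees\<close>

lemma prob_space_unif01: "prob_space unif01"
  unfolding unif01_def by (rule prob_space_restrict_space) auto

lemma space_unif01 [simp]: "space unif01 = {0..1}"
  by (simp add: unif01_def)

lemma measurable_unif01_borel [measurable]: "(\<lambda>x. x) \<in> borel_measurable unif01"
  unfolding unif01_def by (rule measurable_restrict_space1) simp

lemma measure_unif01_atMost:
  assumes "0 \<le> a" "a \<le> 1"
  shows "measure unif01 {u \<in> space unif01. u \<le> a} = a"
proof -
  have eq: "{u \<in> space unif01. u \<le> a} = {0..a}" using assms by auto
  have "measure unif01 {0..a} = measure lborel {0..a}"
    unfolding unif01_def by (rule measure_restrict_space) (use assms in auto)
  with assms show ?thesis unfolding eq by simp
qed

definition vertex_law :: "nat pmf \<Rightarrow> (nat \<times> real) measure" where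
  "vertex_law p = measure_pmf p \<Otimes>\<^sub>M unif01"

lemma gw_measure_eq: "gw_measure p = PiM UNIV (\<lambda>_. vertex_law p)"
  by (simp add: gw_measure_def vertex_law_def)

lemma prob_space_vertex_law: "prob_space (vertex_law p)"
  unfolding vertex_law_def
  by (rule prob_space_pair) (use prob_space_unif01 measure_pmf.prob_space_axioms in auto)

lemma prob_space_gw_measure: "prob_space (gw_measure p)"
  unfolding gw_measure_eq by (rule prob_space_PiM) (rule prob_space_vertex_law)

lemma measurable_fst_vertex_law [measurable]: "fst \<in> measurable (vertex_law p) (count_space UNIV)"
  unfolding vertex_law_def by measurable

lemma measurable_snd_vertex_law [measurable]: "snd \<in> borel_measurable (vertex_law p)"
  unfolding vertex_law_def
  by (rule measurable_compose[OF measurable_snd measurable_unif01_borel])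

section \<open>Subtrees as shifted configurations, and independence of disjoint ones\<close>

lemma measurable_reindex:
  assumes "range f \<subseteq> K"
  shows "(\<lambda>\<omega> w. \<omega> (f w)) \<in> measurable (PiM K (\<lambda>_. N)) (PiM UNIV (\<lambda>_. N))"
proof (rule measurable_PiM_single')
  show "(\<lambda>\<omega>. \<omega> (f i)) \<in> measurable (PiM K (\<lambda>_. N)) N" for i
    by (rule measurable_component_singleton) (use assms in auto)
  show "(\<lambda>\<omega> w. \<omega> (f w)) \<in> space (PiM K (\<lambda>_. N)) \<rightarrow> (\<Pi>\<^sub>E i\<in>UNIV. space N)"
    using assms by (auto simp: space_PiM)
qed

lemma measurable_open_path:
  "Measurable.pred (PiM UNIV (\<lambda>_. vertex_law p)) (open_path a n)"
proof (induction n)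
  case 0
  then show ?case by simp
next
  case (Suc n)
  have [measurable]: "Measurable.pred (PiM UNIV (\<lambda>_. vertex_law p)) (\<lambda>\<omega>. open_path a n (\<lambda>w. \<omega> (i # w)))" for i
    by (rule measurable_compose[OF measurable_reindex Suc]) simp
  show ?case by simp
qed

definition open_prob :: "nat pmf \<Rightarrow> real \<Rightarrow> nat \<Rightarrow> real" where
  "open_prob p a n = measure (gw_measure p) {\<omega> \<in> space (gw_measure p). open_path a n \<omega>}"

text \<open>Reading i.i.d. labels along an injection leaves their law unchanged. The injections of
  interest are shifts into a subtree.\<close>

lemma open_prob_reindex:
  assumes "inj f"
  shows "measure (gw_measure p) {\<omega> \<in> space (gw_measure p). open_path a n (\<lambda>w. \<omega> (f w))} = open_prob p a n"
proof -
  let ?G = "PiM UNIV (\<lambda>_::vertex. vertex_law p)" and ?s = "\<lambda>\<omega> w. \<omega> (f w)"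
  have s: "?s \<in> measurable ?G ?G" by (rule measurable_reindex) simp
  have "distr ?G ?G (\<lambda>\<omega>. \<lambda>n\<in>UNIV. \<omega> (f n)) = ?G"
    using distr_PiM_reindex[of UNIV "\<lambda>_. vertex_law p" f UNIV] prob_space_vertex_law assms by simp
  then have "distr ?G ?G ?s = ?G" by (simp add: restrict_UNIV)
  then have "open_prob p a n = measure (distr ?G ?G ?s) {\<omega> \<in> space ?G. open_path a n \<omega>}"
    by (simp add: open_prob_def gw_measure_eq)
  also have "\<dots> = measure ?G (?s -` {\<omega> \<in> space ?G. open_path a n \<omega>} \<inter> space ?G)"
    using measurable_open_path by (intro measure_distr[OF s]) (simp add: pred_def)
  also have "?s -` {\<omega> \<in> space ?G. open_path a n \<omega>} \<inter> space ?G =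
      {\<omega> \<in> space ?G. open_path a n (\<lambda>w. \<omega> (f w))}"
    using measurable_space[OF s] by auto
  finally show ?thesis by (simp add: gw_measure_eq)
qed

text \<open>Independence of events on disjoint blocks of coordinates; writing
  \<open>restrict\<close> inside \<open>R j\<close> expresses that the event sees its own block
  only.\<close>

lemma prob_restrict_disjoint:
  fixes N :: "'b measure" and K :: "'c \<Rightarrow> 'a set"
  assumes N: "prob_space N" and L: "finite L" "L \<noteq> {}" and K: "disjoint_family_on K L"
    and R: "\<And>j. j \<in> L \<Longrightarrow> Measurable.pred (PiM (K j) (\<lambda>_. N)) (R j)"
  defines "G \<equiv> PiM UNIV (\<lambda>_. N)"
  shows "measure G {\<omega> \<in> space G. \<forall>j\<in>L. R j (restrict \<omega> (K j))} =
    (\<Prod>j\<in>L. measure G {\<omega> \<in> space G. R j (restrict \<omega> (K j))})"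
proof -
  interpret G: prob_space G unfolding G_def by (rule prob_space_PiM) (rule N)
  have "G.indep_vars (\<lambda>_. N) (\<lambda>i \<omega>. \<omega> i) UNIV"
    unfolding G_def by (rule indep_vars_PiM_coordinates) (use N in auto)
  then have "G.indep_vars (\<lambda>j. PiM (K j) (\<lambda>_. N)) (\<lambda>j \<omega>. restrict \<omega> (K j)) L"
    using G.indep_vars_restrict[of "\<lambda>_. N" "\<lambda>i \<omega>. \<omega> i" UNIV L K] K by simp
  then have "G.indep_vars (\<lambda>_. count_space UNIV) (\<lambda>j \<omega>. R j (restrict \<omega> (K j))) L"
    by (rule G.indep_vars_compose2) (rule R)
  from G.indep_varsD[OF this L(2,1) subset_refl, of "\<lambda>_. {True}"]
  have "measure G (\<Inter>j\<in>L. {\<omega> \<in> space G. R j (restrict \<omega> (K j))}) =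
    (\<Prod>j\<in>L. measure G {\<omega> \<in> space G. R j (restrict \<omega> (K j))})"
    by (simp add: vimage_def Int_def conj_commute)
  moreover have "(\<Inter>j\<in>L. {\<omega> \<in> space G. R j (restrict \<omega> (K j))}) =
      {\<omega> \<in> space G. \<forall>j\<in>L. R j (restrict \<omega> (K j))}"
    using L(2) by auto
  ultimately show ?thesis by simp
qed

lemma gw_measure_root:
  assumes "0 \<le> a" "a \<le> 1"
  shows "measure (gw_measure p) {\<omega> \<in> space (gw_measure p). fst (\<omega> v) = k \<and> snd (\<omega> v) \<le> a} = pmf p k * a"
proof -
  let ?G = "PiM UNIV (\<lambda>_::vertex. vertex_law p)"
  let ?X = "{x \<in> space (vertex_law p). fst x = k \<and> snd x \<le> a}"
  interpret U: prob_space unif01 by (rule prob_space_unif01)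
  have X: "?X \<in> sets (vertex_law p)" by measurable
  have Y: "{u \<in> space unif01. u \<le> a} \<in> sets unif01" by measurable
  have "measure (vertex_law p) ?X = measure (distr ?G (vertex_law p) (\<lambda>\<omega>. \<omega> v)) ?X"
    using distr_PiM_component[of UNIV "\<lambda>_. vertex_law p" v] prob_space_vertex_law by simp
  also have "\<dots> = measure ?G ((\<lambda>\<omega>. \<omega> v) -` ?X \<inter> space ?G)"
    by (rule measure_distr[OF _ X]) measurable
  also have "(\<lambda>\<omega>. \<omega> v) -` ?X \<inter> space ?G = {\<omega> \<in> space ?G. fst (\<omega> v) = k \<and> snd (\<omega> v) \<le> a}"
    by (auto simp: space_PiM)
  finally have "measure ?G {\<omega> \<in> space ?G. fst (\<omega> v) = k \<and> snd (\<omega> v) \<le> a} = measure (vertex_law p) ?X" ..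
  also have "?X = {k} \<times> {u \<in> space unif01. u \<le> a}"
    by (auto simp: vertex_law_def space_pair_measure)
  also have "measure (vertex_law p) \<dots> = measure (measure_pmf p) {k} * measure unif01 {u \<in> space unif01. u \<le> a}"
    unfolding vertex_law_def measure_def
    by (subst U.emeasure_pair_measure_Times) (use Y in \<open>auto simp: enn2real_mult\<close>)
  also have "\<dots> = pmf p k * a" using measure_unif01_atMost[OF assms] by (simp add: measure_pmf_single)
  finally show ?thesis by (simp add: gw_measure_eq)
qed

lemma open_prob_0:
  assumes "0 \<le> a" "a \<le> 1"
  shows "open_prob p a 0 = a"
proof -
  interpret prob_space "gw_measure p" by (rule prob_space_gw_measure)
  have "(\<lambda>k. measure (gw_measure p) {\<omega> \<in> space (gw_measure p). fst (\<omega> []) = k \<and> snd (\<omega> []) \<le> a}) sums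
    measure (gw_measure p) (\<Union>k. {\<omega> \<in> space (gw_measure p). fst (\<omega> []) = k \<and> snd (\<omega> []) \<le> a})"
    by (rule finite_measure_UNION) (auto simp: gw_measure_eq disjoint_family_on_def)
  moreover have "(\<Union>k. {\<omega> \<in> space (gw_measure p). fst (\<omega> []) = k \<and> snd (\<omega> []) \<le> a}) =
      {\<omega> \<in> space (gw_measure p). open_path a 0 \<omega>}" by auto
  ultimately have "(\<lambda>k. pmf p k * a) sums open_prob p a 0"
    by (simp add: gw_measure_root[OF assms] open_prob_def)
  moreover have "(\<lambda>k. pmf p k * a) sums (1 * a)"
    by (rule sums_mult2) (use measure_pmf.finite_measure_UNION[of "\<lambda>k. {k}" p] in \<open>simp add: disjoint_family_on_def measure_pmf_single\<close>)
  ultimately show ?thesis using sums_unique2 by fastforce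
qed

text \<open>Condition on the root degree \<open>k\<close>: the subtrees of the \<open>k\<close>
  children are independent copies, and depth \<open>Suc n\<close> is missed exactly when the root is
  closed or all \<open>k\<close> copies fail at depth \<open>n\<close>.\<close>

lemma open_prob_Suc:
  assumes "0 \<le> a" "a \<le> 1"
  shows "(\<lambda>k. pmf p k * (a * (1 - (1 - open_prob p a n) ^ k))) sums open_prob p a (Suc n)"
proof -
  let ?G = "PiM UNIV (\<lambda>_::vertex. vertex_law p)"
  interpret G: prob_space ?G using prob_space_gw_measure[of p] by (simp add: gw_measure_eq)
  define D where "D k = {\<omega> \<in> space ?G. fst (\<omega> []) = k \<and> snd (\<omega> []) \<le> a}" for k
  define E where "E k = {\<omega> \<in> D k. \<exists>i<k. open_path a n (\<lambda>w. \<omega> (i # w))}" for k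
  have op [measurable]: "Measurable.pred ?G (\<lambda>\<omega>. open_path a n (\<lambda>w. \<omega> (i # w)))" for i
    by (rule measurable_compose[OF measurable_reindex measurable_open_path]) simp
  have D: "D k \<in> sets ?G" for k unfolding D_def by measurable
  have E: "E k \<in> sets ?G" for k unfolding E_def D_def by measurable
  have mD: "measure ?G (D k) = pmf p k * a" for k
    using gw_measure_root[OF assms, of p "[]" k] by (simp add: D_def gw_measure_eq)
  have mE: "measure ?G (E k) = pmf p k * (a * (1 - (1 - open_prob p a n) ^ k))" for k
  proof -
    \<comment> \<open>Block \<open>None\<close> is the root coordinate and block
      \<open>Some i\<close> the subtree of child \<open>i\<close>. The joint event is an open root
      of degree \<open>k\<close> all of whose children fail, which is
      \<open>D k - E k\<close>.\<close>
    define K where "K j = (case j of None \<Rightarrow> {[]} | Some i \<Rightarrow> range ((#) i))" for j :: "nat option"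
    define R where "R j f = (case j of None \<Rightarrow> fst (f []) = k \<and> snd (f []) \<le> a
      | Some i \<Rightarrow> \<not> open_path a n (\<lambda>w. f (i # w)))" for j and f :: "vertex \<Rightarrow> nat \<times> real"
    define L where "L = insert None (Some ` {..<k})"
    have "Measurable.pred (PiM (K j) (\<lambda>_. vertex_law p)) (R j)" for j
    proof (cases j)
      case None
      then show ?thesis by (simp add: K_def R_def[abs_def])
    next
      case (Some i)
      have "Measurable.pred (PiM (range ((#) i)) (\<lambda>_. vertex_law p)) (\<lambda>f. open_path a n (\<lambda>w. f (i # w)))"
        by (rule measurable_compose[OF measurable_reindex measurable_open_path]) simp
      with Some show ?thesis by (simp add: K_def R_def[abs_def])
    qed
    then have "measure ?G {\<omega> \<in> space ?G. \<forall>j\<in>L. R j (restrict \<omega> (K j))} =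
        (\<Prod>j\<in>L. measure ?G {\<omega> \<in> space ?G. R j (restrict \<omega> (K j))})"
      by (intro prob_restrict_disjoint prob_space_vertex_law)
         (auto simp: L_def K_def disjoint_family_on_def split: option.splits)
    also have "\<dots> = measure ?G (D k) * (\<Prod>i<k. measure ?G {\<omega> \<in> space ?G. \<not> open_path a n (\<lambda>w. \<omega> (i # w))})"
      unfolding L_def by (subst prod.insert) (auto simp: prod.reindex R_def K_def D_def)
    also have "(\<lambda>i. measure ?G {\<omega> \<in> space ?G. \<not> open_path a n (\<lambda>w. \<omega> (i # w))}) = (\<lambda>_. 1 - open_prob p a n)"
    proof
      fix i
      have "measure ?G {\<omega> \<in> space ?G. open_path a n (\<lambda>w. \<omega> (i # w))} = open_prob p a n"
        using open_prob_reindex[of "(#) i" p a n] by (simp add: gw_measure_eq)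
      then show "measure ?G {\<omega> \<in> space ?G. \<not> open_path a n (\<lambda>w. \<omega> (i # w))} = 1 - open_prob p a n"
        by (subst G.prob_neg) (use op[of i] in \<open>simp_all add: pred_def\<close>)
    qed
    also have "{\<omega> \<in> space ?G. \<forall>j\<in>L. R j (restrict \<omega> (K j))} = D k - E k"
      by (auto simp: L_def R_def K_def D_def E_def)
    finally have "measure ?G (D k - E k) = pmf p k * a * (1 - open_prob p a n) ^ k"
      by (simp add: mD)
    moreover have "measure ?G (D k - E k) = measure ?G (D k) - measure ?G (E k)"
      by (rule G.finite_measure_Diff[OF D E]) (auto simp: E_def)
    ultimately show ?thesis by (simp add: mD algebra_simps)
  qed
  have "(\<lambda>k. measure ?G (E k)) sums measure ?G (\<Union>k. E k)"
    by (rule G.finite_measure_UNION) (use E in \<open>auto simp: E_def D_def disjoint_family_on_def\<close>)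
  moreover have "(\<Union>k. E k) = {\<omega> \<in> space ?G. open_path a (Suc n) \<omega>}"
    by (auto simp: E_def D_def)
  ultimately show ?thesis by (simp add: mE open_prob_def gw_measure_eq)
qed

section \<open>The branching recursion at and above criticality\<close>

lemma pmf_sums_expectation:
  fixes f :: "nat \<Rightarrow> real"
  assumes "integrable (measure_pmf p) f"
  shows "(\<lambda>k. pmf p k * f k) sums measure_pmf.expectation p f"
proof -
  have "integrable (count_space UNIV) (\<lambda>k. pmf p k * f k)"
    using assms by (simp add: measure_pmf_eq_density integrable_density)
  from sums_integral_count_space_nat[OF this] show ?thesis
    by (simp add: measure_pmf_eq_density integral_density)
qed

text \<open>Union bound for \<open>k\<close> independent events of probability \<open>h\<close>,
  improved by a quadratic term as soon as \<open>k\<close> is at least 2. This gain drives the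
  critical probabilities to 0.\<close>

lemma power_diff_upper:
  fixes h :: real
  assumes "0 \<le> h" "h \<le> 1"
  shows "1 - (1 - h) ^ k \<le> real k * h - (if 2 \<le> k then h\<^sup>2 else 0)"
proof (induction k)
  case (Suc k)
  show ?case
  proof (cases "2 \<le> k")
    case True
    then have "real k * h - h\<^sup>2 \<ge> 1 - (1 - h) ^ k" using Suc by simp
    then have "(1 - h) * (1 - real k * h + h\<^sup>2) \<le> (1 - h) * (1 - h) ^ k"
      using assms by (intro mult_left_mono) auto
    moreover have "(1 - h) * (1 - real k * h + h\<^sup>2) = 1 - real (Suc k) * h + h\<^sup>2 + h\<^sup>2 * (real k - h)"
      by (simp add: algebra_simps power2_eq_square)
    moreover have "0 \<le> h\<^sup>2 * (real k - h)" using assms True by (intro mult_nonneg_nonneg) auto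
    ultimately show ?thesis using True by simp
  next
    case False
    then have "k = 0 \<or> k = 1" by auto
    then show ?thesis by (auto simp: power2_eq_square algebra_simps)
  qed
qed simp

text \<open>Bonferroni with a crude quadratic correction, chosen so that averaging over the degree
  produces the second moment.\<close>

lemma power_diff_lower:
  fixes h :: real
  assumes "0 \<le> h" "h \<le> 1"
  shows "real k * h - (real k)\<^sup>2 * h\<^sup>2 \<le> 1 - (1 - h) ^ k"
proof (induction k)
  case (Suc k)
  have nonneg: "0 \<le> real k * h\<^sup>2 + h\<^sup>2 + (real k)\<^sup>2 * h\<^sup>2 * h" using assms by simp
  have "(1 - h) * (1 - h) ^ k \<le> (1 - h) * (1 - real k * h + (real k)\<^sup>2 * h\<^sup>2)"
    using Suc assms by (intro mult_left_mono) auto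
  also have "\<dots> = 1 - real (Suc k) * h + (real (Suc k))\<^sup>2 * h\<^sup>2 - (real k * h\<^sup>2 + h\<^sup>2 + (real k)\<^sup>2 * h\<^sup>2 * h)"
    by (simp add: algebra_simps power2_eq_square)
  also have "\<dots> \<le> 1 - real (Suc k) * h + (real (Suc k))\<^sup>2 * h\<^sup>2"
    using nonneg by linarith
  finally show ?case by simp
qed simp

lemma open_prob_bounds: "0 \<le> open_prob p a n" "open_prob p a n \<le> 1"
proof -
  interpret prob_space "gw_measure p" by (rule prob_space_gw_measure)
  show "0 \<le> open_prob p a n" "open_prob p a n \<le> 1"
    by (simp_all add: open_prob_def)
qed

text \<open>At level \<open>1 / \<mu>\<close> the linear term of the recursion has slope 1, and the
  quadratic loss makes the sequence decrease. Its limit satisfies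
  \<open>L \<le> L - c * L^2\<close>, hence vanishes. A degree \<open>k0\<close> of at least 2 with
  positive mass exists because otherwise the mean would be at most 1.\<close>

lemma open_prob_critical:
  assumes int: "integrable (measure_pmf p) real" and \<mu>: "\<mu> = measure_pmf.expectation p real" "1 < \<mu>"
  shows "open_prob p (1 / \<mu>) \<longlonglongrightarrow> 0"
proof -
  let ?h = "open_prob p (1 / \<mu>)"
  have a: "0 \<le> 1 / \<mu>" "1 / \<mu> \<le> 1" using \<mu> by auto
  have mean: "(\<lambda>k. pmf p k * real k) sums \<mu>" using pmf_sums_expectation[OF int] \<mu>(1) by simp
  have "\<exists>k\<ge>2. 0 < pmf p k"
  proof (rule ccontr)
    assume "\<not> ?thesis"
    then have "set_pmf p \<subseteq> {..1}" by (metis atMost_iff not_less_eq_eq numeral_2_eq_2 One_nat_def pmf_positive subsetI)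
    then have "measure_pmf.expectation p real \<le> measure_pmf.expectation p (\<lambda>_. 1)"
      by (intro integral_mono_AE int) (auto simp: AE_measure_pmf_iff)
    with \<mu> show False by simp
  qed
  then obtain k0 where k0: "2 \<le> k0" "0 < pmf p k0" by auto
  \<comment> \<open>Only the loss of the single degree \<open>k0\<close> is retained, weighted by
    the level \<open>1 / \<mu>\<close>.\<close>
  define c where "c = pmf p k0 / \<mu>"
  have c: "0 < c" using k0 \<mu> by (simp add: c_def)
  have step: "?h (Suc n) \<le> ?h n - c * (?h n)\<^sup>2" for n
  proof (rule sums_le)
    show "(\<lambda>k. pmf p k * (1 / \<mu> * (1 - (1 - ?h n) ^ k))) sums ?h (Suc n)"
      by (rule open_prob_Suc[OF a])
    have "(\<lambda>k. pmf p k * real k * (?h n / \<mu>) - (if k = k0 then c * (?h n)\<^sup>2 else 0)) sums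
        (\<mu> * (?h n / \<mu>) - c * (?h n)\<^sup>2)"
      by (intro sums_diff sums_mult2 mean sums_single[of k0 "\<lambda>_. c * (?h n)\<^sup>2"])
    then show "(\<lambda>k. pmf p k * real k * (?h n / \<mu>) - (if k = k0 then c * (?h n)\<^sup>2 else 0)) sums
        (?h n - c * (?h n)\<^sup>2)" using \<mu> by simp
    show "pmf p k * (1 / \<mu> * (1 - (1 - ?h n) ^ k)) \<le>
        pmf p k * real k * (?h n / \<mu>) - (if k = k0 then c * (?h n)\<^sup>2 else 0)" for k
    proof -
      have "pmf p k * (1 / \<mu> * (1 - (1 - ?h n) ^ k)) \<le>
          pmf p k * (1 / \<mu> * (real k * ?h n - (if 2 \<le> k then (?h n)\<^sup>2 else 0)))"
        using power_diff_upper[of "?h n" k] open_prob_bounds[of p "1 / \<mu>" n] a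
        by (intro mult_left_mono) auto
      also have "\<dots> = pmf p k * real k * (?h n / \<mu>) - (if 2 \<le> k then pmf p k / \<mu> * (?h n)\<^sup>2 else 0)"
        by (simp add: algebra_simps)
      also have "\<dots> \<le> pmf p k * real k * (?h n / \<mu>) - (if k = k0 then c * (?h n)\<^sup>2 else 0)"
        using k0 \<mu> by (auto simp: c_def)
      finally show ?thesis .
    qed
  qed
  have "decseq ?h"
  proof (rule decseq_SucI)
    have "0 \<le> c * (?h n)\<^sup>2" for n using c by simp
    then show "?h (Suc n) \<le> ?h n" for n using step[of n] by (smt (verit))
  qed
  then obtain L where L: "?h \<longlonglongrightarrow> L" "\<And>n. L \<le> ?h n"
    using decseq_convergent[of ?h 0] open_prob_bounds by metis
  have "L \<le> L - c * L\<^sup>2"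
  proof (rule LIMSEQ_le[OF LIMSEQ_Suc[OF L(1)]])
    show "(\<lambda>n. ?h n - c * (?h n)\<^sup>2) \<longlonglongrightarrow> L - c * L\<^sup>2" by (intro tendsto_intros L(1))
  qed (use step in auto)
  with c have "L = 0" by (simp add: mult_le_0_iff)
  with L show ?thesis by simp
qed

text \<open>The recursion is monotone in the previous probability and has slope
  \<open>a * \<mu> > 1\<close> at 0, so a small enough \<open>h\<close> stays a lower bound forever.
  The second moment controls the quadratic error.\<close>

lemma open_prob_supercritical:
  assumes int: "integrable (measure_pmf p) real" and int2: "integrable (measure_pmf p) (\<lambda>k. (real k)\<^sup>2)"
    and \<mu>: "\<mu> = measure_pmf.expectation p real" "1 < \<mu>" and a: "1 / \<mu> < a" "a \<le> 1"
  shows "\<exists>h>0. \<forall>n. h \<le> open_prob p a n"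
proof -
  define m where "m = measure_pmf.expectation p (\<lambda>k. (real k)\<^sup>2)"
  have "0 \<le> m" unfolding m_def by simp
  have mean: "(\<lambda>k. pmf p k * real k) sums \<mu>" using pmf_sums_expectation[OF int] \<mu>(1) by simp
  have second: "(\<lambda>k. pmf p k * (real k)\<^sup>2) sums m" using pmf_sums_expectation[OF int2] by (simp add: m_def)
  have "0 < 1 / \<mu>" using \<mu> by simp
  with a have a0: "0 < a" by linarith
  have am: "1 < a * \<mu>" using a \<mu> by (simp add: field_simps)
  \<comment> \<open>The second entry gives \<open>a * m * h \<le> a * \<mu> - 1\<close>, that is,
    one step of the recursion maps \<open>h\<close> to at least \<open>h\<close>;
    \<open>m + 1\<close> keeps the denominator positive. The first entry serves depth 0, where the
    probability is \<open>a\<close>.\<close>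
  define h where "h = min a ((a * \<mu> - 1) / (a * (m + 1)))"
  have h: "0 < h" "h \<le> a" using a0 am \<open>0 \<le> m\<close> by (auto simp: h_def)
  have "h \<le> (a * \<mu> - 1) / (a * (m + 1))" by (simp add: h_def)
  then have "h * (a * (m + 1)) \<le> a * \<mu> - 1" using a0 \<open>0 \<le> m\<close> by (simp add: pos_le_divide_eq)
  then have "a * m * h \<le> a * \<mu> - 1" using mult_pos_pos[OF h(1) a0] by (simp add: algebra_simps)
  then have "h * (a * m * h) \<le> h * (a * \<mu> - 1)" using h by (intro mult_left_mono) auto
  then have key: "h \<le> \<mu> * (a * h) - m * (a * h\<^sup>2)" by (simp add: algebra_simps power2_eq_square)
  have "h \<le> open_prob p a n" for n
  proof (induction n)
    case 0
    then show ?case using open_prob_0[of a p] a0 a h by simp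
  next
    case (Suc n)
    let ?q = "open_prob p a n"
    have "\<mu> * (a * h) - m * (a * h\<^sup>2) \<le> open_prob p a (Suc n)"
    proof (rule sums_le)
      show "(\<lambda>k. pmf p k * (a * (1 - (1 - ?q) ^ k))) sums open_prob p a (Suc n)"
        using a a0 by (intro open_prob_Suc) auto
      show "(\<lambda>k. pmf p k * real k * (a * h) - pmf p k * (real k)\<^sup>2 * (a * h\<^sup>2)) sums
          (\<mu> * (a * h) - m * (a * h\<^sup>2))"
        by (intro sums_diff sums_mult2 mean second)
      show "pmf p k * real k * (a * h) - pmf p k * (real k)\<^sup>2 * (a * h\<^sup>2) \<le>
          pmf p k * (a * (1 - (1 - ?q) ^ k))" for k
      proof -
        have "real k * h - (real k)\<^sup>2 * h\<^sup>2 \<le> 1 - (1 - h) ^ k"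
          using h a by (intro power_diff_lower) auto
        also have "\<dots> \<le> 1 - (1 - ?q) ^ k"
          using Suc open_prob_bounds[of p a n] by (simp add: power_mono)
        finally have "pmf p k * (a * (real k * h - (real k)\<^sup>2 * h\<^sup>2)) \<le> pmf p k * (a * (1 - (1 - ?q) ^ k))"
          using a0 by (intro mult_left_mono) auto
        then show ?thesis by (simp add: algebra_simps)
      qed
    qed
    with key show ?case by simp
  qed
  with h show ?thesis by blast
qed

section \<open>From paths of depth \<open>n\<close> to arbitrarily deep paths\<close>

lemma sets_open_path_reindex:
  "{\<omega> \<in> space (gw_measure p). open_path a n (\<lambda>w. \<omega> (f w))} \<in> sets (gw_measure p)"
  using measurable_compose[OF measurable_reindex measurable_open_path, of f UNIV a n p]
  by (simp add: gw_measure_eq pred_def)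

lemma AE_no_critical_path:
  assumes "integrable (measure_pmf p) real" "\<mu> = measure_pmf.expectation p real" "1 < \<mu>"
  shows "AE \<omega> in gw_measure p. \<forall>v. \<exists>n. \<not> open_path (1 / \<mu>) n (\<lambda>w. \<omega> (v @ w))"
proof (subst AE_all_countable, rule allI)
  fix v :: vertex
  interpret prob_space "gw_measure p" by (rule prob_space_gw_measure)
  let ?B = "\<lambda>n. {\<omega> \<in> space (gw_measure p). open_path (1 / \<mu>) n (\<lambda>w. \<omega> (v @ w))}"
  let ?N = "\<Inter>n. ?B n"
  have B: "?B n \<in> events" for n by (rule sets_open_path_reindex)
  have "measure (gw_measure p) ?N \<le> open_prob p (1 / \<mu>) n" for n
    using open_prob_reindex[of "\<lambda>w. v @ w" p "1 / \<mu>" n] finite_measure_mono[of ?N "?B n"] B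
    by (auto simp: inj_def)
  then have "measure (gw_measure p) ?N \<le> 0"
    using LIMSEQ_le_const[OF open_prob_critical[OF assms]] by blast
  then have "measure (gw_measure p) ?N = 0" by (simp add: measure_le_0_iff)
  then have "?N \<in> null_sets (gw_measure p)"
    using B by (intro null_setsI) (auto simp: emeasure_eq_measure)
  from AE_not_in[OF this] AE_space
  show "AE \<omega> in gw_measure p. \<exists>n. \<not> open_path (1 / \<mu>) n (\<lambda>w. \<omega> (v @ w))"
    by eventually_elim auto
qed

text \<open>Continuity from above: the events decrease in the depth and all have probability at
  least \<open>h\<close>.\<close>

lemma prob_open_forever:
  assumes "inj f" "\<And>n. h \<le> open_prob p a n"
  shows "h \<le> measure (gw_measure p) {\<omega> \<in> space (gw_measure p). \<forall>n. open_path a n (\<lambda>w. \<omega> (f w))}"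
proof -
  interpret prob_space "gw_measure p" by (rule prob_space_gw_measure)
  let ?B = "\<lambda>n. {\<omega> \<in> space (gw_measure p). open_path a n (\<lambda>w. \<omega> (f w))}"
  have "(\<lambda>n. measure (gw_measure p) (?B n)) \<longlonglongrightarrow> measure (gw_measure p) (\<Inter>n. ?B n)"
    by (rule finite_Lim_measure_decseq)
       (use sets_open_path_reindex in \<open>auto simp: decseq_def intro: open_path_antimono\<close>)
  then have "h \<le> measure (gw_measure p) (\<Inter>n. ?B n)"
    by (rule LIMSEQ_le_const) (use assms open_prob_reindex in auto)
  moreover have "(\<Inter>n. ?B n) = {\<omega> \<in> space (gw_measure p). \<forall>n. open_path a n (\<lambda>w. \<omega> (f w))}" by auto
  ultimately show ?thesis by simp
qed

section \<open>Weights accepted by the invasion\<close>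

lemma measurable_finite_set:
  fixes f :: "'a \<Rightarrow> 'b::countable set"
  assumes fin: "\<And>x. x \<in> space M \<Longrightarrow> finite (f x)" and [measurable]: "\<And>v. Measurable.pred M (\<lambda>x. v \<in> f x)"
  shows "f \<in> measurable M (count_space {F. finite F})"
\<comment> \<open>The finite subsets of a countable type are countable, so preimages of singletons
  suffice, and these are countable intersections of membership conditions.\<close>
proof (subst measurable_count_space_eq_countable[OF countable_Collect_finite], intro conjI ballI)
  show "f \<in> space M \<rightarrow> {F. finite F}" using fin by auto
  fix F :: "'b set"
  have "f -` {F} \<inter> space M = {x \<in> space M. \<forall>v. v \<in> f x \<longleftrightarrow> v \<in> F}" by auto
  also have "\<dots> \<in> sets M" by measurable
  finally show "f -` {F} \<inter> space M \<in> sets M" .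
qed

lemma measurable_gw_tree:
  "Measurable.pred (PiM UNIV (\<lambda>_. vertex_law p)) (\<lambda>\<omega>. v \<in> gw_tree (\<lambda>u. fst (\<omega> u)))"
proof (induction v rule: rev_induct)
  case Nil
  then show ?case by (simp add: gw_tree.root)
next
  case (snoc i v)
  note [measurable] = snoc
  show ?case unfolding gw_tree_snoc_iff by measurable
qed

text \<open>The step sets take countably many values. For each fixed value \<open>F\<close> the next
  step is measurable, and these pieces are glued along the countable range.\<close>

lemma measurable_invasion_step:
  "(\<lambda>\<omega>. invasion_step (gw_tree (\<lambda>u. fst (\<omega> u))) (\<lambda>u. snd (\<omega> u)) n) \<in>
     measurable (PiM UNIV (\<lambda>_. vertex_law p)) (count_space {F. finite F})"
    (is "?I n \<in> measurable ?G ?C")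
proof (induction n)
  case 0
  then show ?case by simp
next
  case (Suc n)
  let ?T = "\<lambda>\<omega>::vertex \<Rightarrow> nat \<times> real. gw_tree (\<lambda>u. fst (\<omega> u))" and ?U = "\<lambda>\<omega>::vertex \<Rightarrow> nat \<times> real. \<lambda>u. snd (\<omega> u)"
  \<comment> \<open>\<open>ARG_MIN\<close> applies a fixed choice function to the random finite set
    of minimisers, so ties do no harm to measurability.\<close>
  have min: "(\<lambda>\<omega>. ARG_MIN (?U \<omega>) v. v \<in> B) \<in> measurable ?G (count_space UNIV)" if "finite B" for B
  proof -
    let ?m = "\<lambda>\<omega>. {v. v \<in> B \<and> (\<forall>w\<in>B. \<not> snd (\<omega> w) < snd (\<omega> v))}"
    have "?m \<in> measurable ?G ?C"
      by (rule measurable_finite_set) (use that in \<open>simp_all add: countable_finite\<close>)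
    then have "(\<lambda>\<omega>. SOME v. v \<in> ?m \<omega>) \<in> measurable ?G (count_space UNIV)"
      by (rule measurable_compose) simp
    moreover have "(ARG_MIN (?U \<omega>) v. v \<in> B) = (SOME v. v \<in> ?m \<omega>)" for \<omega>
      unfolding arg_min_def is_arg_min_def by (rule arg_cong[of _ _ Eps]) auto
    ultimately show ?thesis by simp
  qed
  have ob: "(\<lambda>\<omega>. outer_boundary (?T \<omega>) F) \<in> measurable ?G ?C" if "finite F" for F
  proof (rule measurable_finite_set)
    note [measurable] = measurable_gw_tree
    show "Measurable.pred ?G (\<lambda>\<omega>. v \<in> outer_boundary (?T \<omega>) F)" for v
      unfolding outer_boundary_def by simp
  qed (rule finite_outer_boundary[OF that])
  have step: "(\<lambda>\<omega>. insert (ARG_MIN (?U \<omega>) v. v \<in> outer_boundary (?T \<omega>) F) F) \<in> measurable ?G ?C"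
    if F: "finite F" for F
  proof -
    have "(\<lambda>\<omega>. ARG_MIN (?U \<omega>) v. v \<in> outer_boundary (?T \<omega>) F) \<in> measurable ?G (count_space UNIV)"
      by (rule measurable_compose_countable'[OF min ob[OF F] countable_Collect_finite]) simp
    then show ?thesis by (rule measurable_compose) (use F in simp)
  qed
  have "(\<lambda>\<omega>. (\<lambda>F \<omega>. insert (ARG_MIN (?U \<omega>) v. v \<in> outer_boundary (?T \<omega>) F) F) (?I n \<omega>) \<omega>) \<in>
      measurable ?G ?C"
    by (rule measurable_compose_countable'[OF _ Suc countable_Collect_finite]) (simp add: step)
  then show ?case by simp
qed

lemma measurable_invasion_cluster:
  "Measurable.pred (PiM UNIV (\<lambda>_. vertex_law p))
     (\<lambda>\<omega>. v \<in> invasion_cluster (gw_tree (\<lambda>u. fst (\<omega> u))) (\<lambda>u. snd (\<omega> u)))"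
proof -
  have [measurable]: "Measurable.pred (PiM UNIV (\<lambda>_. vertex_law p))
     (\<lambda>\<omega>. v \<in> invasion_step (gw_tree (\<lambda>u. fst (\<omega> u))) (\<lambda>u. snd (\<omega> u)) n)" for n
    by (rule measurable_compose[OF measurable_invasion_step]) simp
  show ?thesis unfolding invasion_cluster_def by simp
qed

section \<open>The annealed count of accepted large weights\<close>

lemma AE_deg_pos:
  assumes "0 \<notin> set_pmf p"
  shows "AE \<omega> in gw_measure p. \<forall>v. 0 < fst (\<omega> v)"
proof -
  have "AE d in PiM UNIV (\<lambda>_::vertex. measure_pmf p). \<forall>v. 0 < d v"
  proof (subst AE_all_countable, rule allI)
    show "AE d in PiM UNIV (\<lambda>_::vertex. measure_pmf p). 0 < d v" for v
      by (rule AE_PiM_component)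
         (use assms in \<open>auto simp: measure_pmf.prob_space_axioms AE_measure_pmf_iff intro: gr0I\<close>)
  qed
  then show ?thesis
    unfolding gw_measure_def
    by (rule AE_PiM_fst[rotated 2]) (simp_all add: measure_pmf.prob_space_axioms prob_space_unif01)
qed

lemma AE_finite_invaded_above:
  assumes pos: "0 \<notin> set_pmf p" and h: "0 < h" "\<And>n. h \<le> open_prob p a n"
  shows "AE \<omega> in gw_measure p.
    finite {v \<in> invasion_cluster (gw_tree (\<lambda>u. fst (\<omega> u))) (\<lambda>u. snd (\<omega> u)). a < snd (\<omega> v)}"
proof -
  define G where "G = PiM UNIV (\<lambda>_::vertex. vertex_law p)"
  have G: "gw_measure p = G" by (simp add: G_def gw_measure_eq)
  interpret prob_space G using prob_space_gw_measure[of p] by (simp add: G)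
  define C where "C \<omega> = invasion_cluster (gw_tree (\<lambda>u. fst (\<omega> u))) (\<lambda>u. snd (\<omega> u))"
    for \<omega> :: "vertex \<Rightarrow> nat \<times> real"
  \<comment> \<open>The subtree of the first child only: \<open>v\<close> stays outside, because its
    weight belongs to the event \<open>A v\<close>.\<close>
  define below where "below v = range (\<lambda>w. v @ 0 # w)" for v :: vertex
  \<comment> \<open>The default \<open>(1, 0)\<close> below \<open>v\<close> keeps all degrees positive, as \<open>invasion_cluster_cong\<close> requires.\<close>
  define ext where "ext v f = (\<lambda>u. if u \<in> - below v then f u else (1, 0))"
    for v and f :: "vertex \<Rightarrow> nat \<times> real"
  \<comment> \<open>Passing through \<open>ext v\<close> makes this event depend only on labels
    outside \<open>below v\<close>, hence independent of \<open>B v\<close>. On \<open>P\<close> it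
    agrees with the event for the true cluster, by \<open>C_ext\<close>.\<close>
  define A where "A v = {\<omega> \<in> space G. v \<in> C (ext v \<omega>) \<and> a < snd (\<omega> v)}" for v
  define B where "B v = {\<omega> \<in> space G. \<forall>n. open_path a n (\<lambda>w. \<omega> (v @ 0 # w))}" for v
  define P where "P = {\<omega> \<in> space G. \<forall>v. 0 < fst (\<omega> v)}"
  have v: "v \<in> - below v" for v by (auto simp: below_def)
  have ext: "ext v \<in> measurable (PiM (- below v) (\<lambda>_. vertex_law p)) G" for v
    unfolding G_def
  proof (rule measurable_PiM_single')
    show i: "(\<lambda>f. ext v f i) \<in> measurable (PiM (- below v) (\<lambda>_. vertex_law p)) (vertex_law p)" for i
      by (cases "i \<in> below v") (auto simp: ext_def vertex_law_def space_pair_measure)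
    show "ext v \<in> space (PiM (- below v) (\<lambda>_. vertex_law p)) \<rightarrow> (\<Pi>\<^sub>E i\<in>UNIV. space (vertex_law p))"
      using measurable_space[OF i] by (simp add: PiE_iff)
  qed
  have RA: "Measurable.pred (PiM (- below v) (\<lambda>_. vertex_law p)) (\<lambda>f. v \<in> C (ext v f) \<and> a < snd (f v))" for v
  proof -
    have [measurable]: "Measurable.pred (PiM (- below v) (\<lambda>_. vertex_law p)) (\<lambda>f. v \<in> C (ext v f))"
      unfolding C_def by (rule measurable_compose[OF ext[unfolded G_def] measurable_invasion_cluster])
    have [measurable]: "(\<lambda>f. f v) \<in> measurable (PiM (- below v) (\<lambda>_. vertex_law p)) (vertex_law p)"
      by (rule measurable_component_singleton) (rule v)
    show ?thesis by measurable
  qed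
  have RB: "Measurable.pred (PiM (below v) (\<lambda>_. vertex_law p)) (\<lambda>f. \<forall>n. open_path a n (\<lambda>w. f (v @ 0 # w)))" for v
  proof -
    have [measurable]: "Measurable.pred (PiM (below v) (\<lambda>_. vertex_law p)) (\<lambda>f. open_path a n (\<lambda>w. f (v @ 0 # w)))" for n
      by (rule measurable_compose[OF measurable_reindex measurable_open_path]) (simp add: below_def)
    show ?thesis by measurable
  qed
  have restr: "(\<lambda>\<omega>. restrict \<omega> K) \<in> measurable G (PiM K (\<lambda>_. vertex_law p))" for K
    unfolding G_def by (rule measurable_restrict_subset) simp
  have A_eq: "A v = {\<omega> \<in> space G. v \<in> C (ext v (restrict \<omega> (- below v))) \<and> a < snd (restrict \<omega> (- below v) v)}" for v
  proof -
    have "ext v (restrict \<omega> (- below v)) = ext v \<omega>" for \<omega> by (auto simp: ext_def fun_eq_iff)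
    then show ?thesis using v by (auto simp: A_def)
  qed
  have B_eq: "B v = {\<omega> \<in> space G. \<forall>n. open_path a n (\<lambda>w. restrict \<omega> (below v) (v @ 0 # w))}" for v
    by (simp add: B_def below_def)
  have A: "A v \<in> sets G" for v
    using measurable_compose[OF restr RA] unfolding A_eq by (simp add: pred_def)
  have B: "B v \<in> sets G" for v
    using measurable_compose[OF restr RB] unfolding B_eq by (simp add: pred_def)
  have P: "P \<in> sets G" unfolding P_def G_def by measurable
  have AE_P: "AE \<omega> in G. \<omega> \<in> P"
    using AE_deg_pos[OF pos] AE_space unfolding G by eventually_elim (simp add: P_def)
  have indep: "measure G (A v \<inter> B v) = measure G (A v) * measure G (B v)" for v
  proof -
    define R where "R b f = (if b then v \<in> C (ext v f) \<and> a < snd (f v) else (\<forall>n. open_path a n (\<lambda>w. f (v @ 0 # w))))"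
      for b and f :: "vertex \<Rightarrow> nat \<times> real"
    define K where "K b = (if b then - below v else below v)" for b
    have "measure G {\<omega> \<in> space G. \<forall>b\<in>UNIV. R b (restrict \<omega> (K b))} =
        (\<Prod>b\<in>UNIV. measure G {\<omega> \<in> space G. R b (restrict \<omega> (K b))})"
      unfolding G_def
      by (rule prob_restrict_disjoint)
         (use RA RB prob_space_vertex_law in \<open>auto simp: R_def[abs_def] K_def disjoint_family_on_def\<close>)
    also have "{\<omega> \<in> space G. \<forall>b\<in>UNIV. R b (restrict \<omega> (K b))} = A v \<inter> B v"
      unfolding A_eq B_eq by (auto simp: R_def K_def UNIV_bool)
    also have "(\<Prod>b\<in>UNIV. measure G {\<omega> \<in> space G. R b (restrict \<omega> (K b))}) = measure G (A v) * measure G (B v)"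
      unfolding A_eq B_eq by (simp add: R_def K_def UNIV_bool mult.commute)
    finally show ?thesis .
  qed
  have C_ext: "v \<in> C (ext v \<omega>) \<longleftrightarrow> v \<in> C \<omega>" if "\<omega> \<in> P" for v \<omega>
    unfolding C_def
    by (rule invasion_cluster_cong[where i = 0])
       (use that in \<open>auto simp: P_def ext_def below_def prefix_def image_iff\<close>)
  \<comment> \<open>The root is left out since it enters without being chosen as a minimiser; a
    single vertex does not affect finiteness.\<close>
  define D where "D v = (if v = [] then {} else A v \<inter> B v \<inter> P)" for v
  have D: "D v \<in> sets G" for v using A B P by (simp add: D_def)
  \<comment> \<open>\<open>list_decode\<close> enumerates the vertices, so that sums over the tree
    become series.\<close>
  have disj: "disjoint_family (\<lambda>n. D (list_decode n))"
  proof -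
    have "v = v'" if \<omega>: "\<omega> \<in> D v" "\<omega> \<in> D v'" for \<omega> v v'
    proof (rule invaded_above_percolation_unique[where d = "\<lambda>u. fst (\<omega> u)" and U = "\<lambda>u. snd (\<omega> u)" and a = a])
      have "\<omega> \<in> P" "v \<noteq> []" "v' \<noteq> []" using \<omega> by (auto simp: D_def split: if_splits)
      then show "v \<noteq> []" "v' \<noteq> []" "\<And>u. 0 < fst (\<omega> u)" by (auto simp: P_def)
      show "v \<in> invasion_cluster (gw_tree (\<lambda>u. fst (\<omega> u))) (\<lambda>u. snd (\<omega> u))" "a < snd (\<omega> v)"
        "v' \<in> invasion_cluster (gw_tree (\<lambda>u. fst (\<omega> u))) (\<lambda>u. snd (\<omega> u))" "a < snd (\<omega> v')"
        using \<omega> C_ext[OF \<open>\<omega> \<in> P\<close>] by (auto simp: D_def A_def C_def split: if_splits)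
      show "open_path a n (\<lambda>w. (fst (\<omega> (v @ 0 # w)), snd (\<omega> (v @ 0 # w))))"
        "open_path a n (\<lambda>w. (fst (\<omega> (v' @ 0 # w)), snd (\<omega> (v' @ 0 # w))))" for n
        using \<omega> by (auto simp: D_def B_def split: if_splits)
    qed
    then show ?thesis unfolding disjoint_family_on_def by (metis disjoint_iff list_decode_eq)
  qed
  have le: "h * measure G (A v) \<le> measure G (D v)" if "v \<noteq> []" for v
  proof -
    have "measure G (D v) = measure G (A v \<inter> B v)"
      by (rule finite_measure_eq_AE) (use AE_P that A B P in \<open>auto simp: D_def\<close>)
    moreover have "h \<le> measure G (B v)"
      using prob_open_forever[of "\<lambda>w. v @ 0 # w" h p a] h by (simp add: B_def G inj_def)
    ultimately show ?thesis
      using indep[of v] mult_left_mono[of h "measure G (B v)" "measure G (A v)"] by (simp add: mult.commute)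
  qed
  let ?A = "\<lambda>v. if v = [] then {} else A v"
  \<comment> \<open>Disjointness makes the probabilities of the \<open>D v\<close> summable;
    division by \<open>h\<close> carries this over to the \<open>A v\<close>.\<close>
  have "(\<lambda>n. measure G (D (list_decode n))) sums measure G (\<Union>n. D (list_decode n))"
    by (rule finite_measure_UNION) (use D disj in auto)
  then have "summable (\<lambda>n. measure G (D (list_decode n)) / h)"
    by (intro summable_divide) (rule sums_summable)
  then have "summable (\<lambda>n. measure G (?A (list_decode n)))"
  proof (rule summable_comparison_test'[where N = 0])
    show "norm (measure G (?A (list_decode n))) \<le> measure G (D (list_decode n)) / h" for n
      using le[of "list_decode n"] h(1) by (simp add: pos_le_divide_eq mult.commute)
  qed
  then have "AE \<omega> in G. eventually (\<lambda>n. \<omega> \<in> space G - ?A (list_decode n)) sequentially"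
    by (intro borel_cantelli_AE1) (use A in \<open>auto simp: emeasure_eq_measure\<close>)
  with AE_P have "AE \<omega> in G. finite {v \<in> C \<omega>. a < snd (\<omega> v)}"
  proof eventually_elim
    fix \<omega> assume \<omega>: "\<omega> \<in> P" "eventually (\<lambda>n. \<omega> \<in> space G - ?A (list_decode n)) sequentially"
    then obtain N where N: "\<And>n. N \<le> n \<Longrightarrow> \<omega> \<notin> ?A (list_decode n)"
      by (auto simp: eventually_sequentially)
    have "{v \<in> C \<omega>. a < snd (\<omega> v)} \<subseteq> insert [] (list_decode ` {..<N})"
    proof (rule subsetI, rule ccontr)
      fix v assume "v \<in> {v \<in> C \<omega>. a < snd (\<omega> v)}" "v \<notin> insert [] (list_decode ` {..<N})"
      then have v: "v \<in> C \<omega>" "a < snd (\<omega> v)" "v \<notin> list_decode ` {..<N}" "v \<noteq> []" by auto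
      have "v = list_decode (list_encode v)" by simp
      with v(3) have "N \<le> list_encode v" by (metis image_eqI lessThan_iff not_less)
      from N[OF this] v \<omega>(1) C_ext[OF \<omega>(1)] show False by (auto simp: A_def P_def)
    qed
    then show "finite {v \<in> C \<omega>. a < snd (\<omega> v)}" by (rule finite_subset) simp
  qed
  then show ?thesis unfolding G C_def .
qed

section \<open>Null sets of the invasion measure\<close>

lemma AE_unif01_neq: "AE y in unif01. y \<noteq> x"
  unfolding unif01_def
  by (subst AE_restrict_space_iff) (use AE_lborel_singleton[of x] in auto)

text \<open>Any two weights are independent, so their joint law is a product of atomless laws, under
  which the diagonal is null. There are countably many pairs of vertices.\<close>

lemma AE_weights_inj: "AE U in PiM UNIV (\<lambda>_::vertex. unif01). inj U"
proof -
  let ?Y = "PiM UNIV (\<lambda>_::vertex. unif01)"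
  interpret U: prob_space unif01 by (rule prob_space_unif01)
  interpret UU: pair_prob_space unif01 unif01 ..
  interpret prob_space ?Y by (rule prob_space_PiM) (rule prob_space_unif01)
  have "AE U in ?Y. v \<noteq> w \<longrightarrow> U v \<noteq> U w" for v w
  proof (cases "v = w")
    case False
    have "indep_vars (\<lambda>_. unif01) (\<lambda>i U. U i) UNIV"
      by (rule indep_vars_PiM_coordinates) (auto simp: prob_space_unif01)
    then have "indep_vars (\<lambda>b. PiM {case_bool v w b} (\<lambda>_. unif01)) (\<lambda>b U. \<lambda>i\<in>{case_bool v w b}. U i) UNIV"
      by (rule indep_vars_restrict) (use False in \<open>auto simp: disjoint_family_on_def split: bool.splits\<close>)
    then have "indep_vars (\<lambda>_. unif01) (\<lambda>b U. (\<lambda>i\<in>{case_bool v w b}. U i) (case_bool v w b)) UNIV"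
      by (rule indep_vars_compose2) simp
    then have "indep_var unif01 (\<lambda>U. U v) unif01 (\<lambda>U. U w)"
      unfolding indep_var_def by (rule indep_vars_cong[THEN iffD1, rotated -1]) (auto split: bool.splits)
    then have "distr ?Y (unif01 \<Otimes>\<^sub>M unif01) (\<lambda>U. (U v, U w)) = unif01 \<Otimes>\<^sub>M unif01"
      using distr_PiM_component[of UNIV "\<lambda>_. unif01" v] distr_PiM_component[of UNIV "\<lambda>_. unif01" w]
      unfolding indep_var_distribution_eq by (simp add: prob_space_unif01)
    moreover have "AE z in unif01 \<Otimes>\<^sub>M unif01. fst z \<noteq> snd z"
    proof (rule UU.AE_pair_measure)
      show "{z \<in> space (unif01 \<Otimes>\<^sub>M unif01). fst z \<noteq> snd z} \<in> sets (unif01 \<Otimes>\<^sub>M unif01)" by measurable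
      show "AE x in unif01. AE y in unif01. fst (x, y) \<noteq> snd (x, y)"
        using AE_unif01_neq by (simp add: eq_commute)
    qed
    ultimately have "AE z in distr ?Y (unif01 \<Otimes>\<^sub>M unif01) (\<lambda>U. (U v, U w)). fst z \<noteq> snd z"
      by (simp only:)
    from AE_distrD[OF _ this] show ?thesis by simp
  qed simp
  then have "AE U in ?Y. \<forall>v w. v \<noteq> w \<longrightarrow> U v \<noteq> U w" by (simp add: AE_all_countable)
  then show ?thesis by eventually_elim (auto simp: inj_def)
qed

text \<open>This makes the measurability of \<^const>\<open>invasion_path\<close> irrelevant.\<close>

lemma emeasure_distr_le: "emeasure (distr M N f) A \<le> emeasure M (f -` A \<inter> space M)"
  unfolding distr_def by (subst emeasure_measure_of_conv) auto

lemma prob_weights_le: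
  assumes "finite J" "0 \<le> a" "a \<le> 1"
  shows "measure (PiM UNIV (\<lambda>_::vertex. unif01)) {U \<in> space (PiM UNIV (\<lambda>_. unif01)). \<forall>v\<in>J. U v \<le> a} = a ^ card J"
proof (cases "J = {}")
  case True
  interpret prob_space "PiM UNIV (\<lambda>_::vertex. unif01)"
    by (rule prob_space_PiM) (rule prob_space_unif01)
  show ?thesis using True by (simp add: prob_space)
next
  case False
  let ?Y = "PiM UNIV (\<lambda>_::vertex. unif01)"
  have "measure ?Y {U \<in> space ?Y. \<forall>v\<in>J. restrict U {v} v \<le> a} =
      (\<Prod>v\<in>J. measure ?Y {U \<in> space ?Y. restrict U {v} v \<le> a})"
    by (rule prob_restrict_disjoint)
       (use assms False in \<open>auto simp: prob_space_unif01 disjoint_family_on_def\<close>)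
  also have "\<dots> = (\<Prod>v\<in>J. a)"
  proof (rule prod.cong[OF refl])
    fix v :: vertex
    have "measure ?Y {U \<in> space ?Y. U v \<le> a} = measure ?Y ((\<lambda>U. U v) -` {u \<in> space unif01. u \<le> a} \<inter> space ?Y)"
      by (rule arg_cong[where f = "measure ?Y"]) (auto simp: space_PiM)
    also have "\<dots> = measure (distr ?Y unif01 (\<lambda>U. U v)) {u \<in> space unif01. u \<le> a}"
      by (rule measure_distr[symmetric]) measurable
    also have "\<dots> = a"
      using distr_PiM_component[of UNIV "\<lambda>_. unif01" v] prob_space_unif01 measure_unif01_atMost assms by simp
    finally show "measure ?Y {U \<in> space ?Y. restrict U {v} v \<le> a} = a" by simp
  qed
  finally show ?thesis by simp
qed

section \<open>Exponentially small sets are avoided\<close>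

lemma finite_gw_tree_level: "finite {v \<in> gw_tree d. length v = n}"
proof (induction n)
  case (Suc n)
  have "{v \<in> gw_tree d. length v = Suc n} \<subseteq>
      (\<Union>v\<in>{v \<in> gw_tree d. length v = n}. (\<lambda>i. v @ [i]) ` {..<d v})"
  proof
    fix v assume "v \<in> {v \<in> gw_tree d. length v = Suc n}"
    then show "v \<in> (\<Union>v\<in>{v \<in> gw_tree d. length v = n}. (\<lambda>i. v @ [i]) ` {..<d v})"
      by (cases v rule: rev_cases) (auto simp: gw_tree_snoc_iff)
  qed
  with Suc show ?case by (auto intro: finite_subset)
qed simp

lemma level_subset: "S \<subseteq> rays (gw_tree d) \<Longrightarrow> level S n \<subseteq> {v \<in> gw_tree d. length v = n}"
  by (auto simp: level_def dest: rays_mem)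

text \<open>Union bound over \<open>level S n\<close>: each vertex there has \<open>n - k\<close>
  distinct ancestors-or-self above height \<open>k\<close>, giving a total of at most
  \<open>c / a ^ k * (q * a) ^ n\<close>. The witness \<open>v\<close> may change with
  \<open>n\<close>, so the event is a countable intersection of finite unions.\<close>

lemma AE_not_eventually_low:
  assumes S: "S \<subseteq> rays (gw_tree d)" and card: "\<And>n. real (card (level S n)) \<le> c * q ^ n"
    and a: "0 < a" "a < 1" and q: "0 \<le> q" "q * a < 1"
  shows "AE U in PiM UNIV (\<lambda>_::vertex. unif01).
    \<not> (\<forall>n. \<exists>v\<in>level S n. \<forall>j. k < j \<longrightarrow> j \<le> n \<longrightarrow> U (take j v) \<le> a)"
proof -
  let ?Y = "PiM UNIV (\<lambda>_::vertex. unif01)"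
  interpret prob_space ?Y by (rule prob_space_PiM) (rule prob_space_unif01)
  define J where "J n v = (\<lambda>j. take j v) ` {k<..n}" for n and v :: vertex
  define E where "E n v = {U \<in> space ?Y. \<forall>u\<in>J n v. U u \<le> a}" for n v
  have E: "E n v \<in> events" for n v
  proof -
    have "finite (J n v)" by (simp add: J_def)
    then show ?thesis unfolding E_def by measurable
  qed
  have fin: "finite (level S n)" for n
    by (rule finite_subset[OF level_subset[OF S] finite_gw_tree_level])
  let ?N = "\<Inter>n. \<Union>v\<in>level S n. E n v"
  have "prob ?N \<le> c / a ^ k * (q * a) ^ n" if n: "k \<le> n" for n
  proof -
    have E_eq: "prob (E n v) = a ^ (n - k)" if "v \<in> level S n" for v
    proof -
      have "length v = n" using that by (simp add: level_def)
      have "card (J n v) = card {k<..n}" unfolding J_def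
      proof (rule card_image, rule inj_onI)
        fix i j assume ij: "i \<in> {k<..n}" "j \<in> {k<..n}" "take i v = take j v"
        have "length (take i v) = length (take j v)" by (simp only: ij(3))
        with ij(1,2) \<open>length v = n\<close> show "i = j" by simp
      qed
      then show ?thesis unfolding E_def using prob_weights_le[of "J n v" a] a by (simp add: J_def)
    qed
    have "prob ?N \<le> prob (\<Union>v\<in>level S n. E n v)"
      by (rule finite_measure_mono) (use E fin in auto)
    also have "\<dots> \<le> (\<Sum>v\<in>level S n. prob (E n v))"
      by (rule finite_measure_subadditive_finite) (use E fin in auto)
    also have "\<dots> = real (card (level S n)) * a ^ (n - k)" by (simp add: E_eq)
    also have "\<dots> \<le> c * q ^ n * a ^ (n - k)" using card[of n] a by (intro mult_right_mono) auto
    also have "\<dots> = c / a ^ k * (q * a) ^ n"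
      using a n by (simp add: power_diff power_mult_distrib)
    finally show ?thesis .
  qed
  moreover have "(\<lambda>n. c / a ^ k * (q * a) ^ n) \<longlonglongrightarrow> c / a ^ k * 0"
    by (intro tendsto_mult tendsto_const LIMSEQ_realpow_zero) (use a q in auto)
  ultimately have "prob ?N \<le> c / a ^ k * 0"
    by (intro LIMSEQ_le_const[of _ "c / a ^ k * 0"]) auto
  then have "prob ?N = 0" by (simp add: measure_le_0_iff)
  moreover have "?N \<in> events" using E fin by (intro sets.countable_INT sets.finite_UN) auto
  ultimately have "?N \<in> null_sets ?Y" by (intro null_setsI) (simp_all add: emeasure_eq_measure)
  from AE_not_in[OF this] AE_space show ?thesis
  proof eventually_elim
    case (elim U)
    show ?case
    proof
      assume "\<forall>n. \<exists>v\<in>level S n. \<forall>j. k < j \<longrightarrow> j \<le> n \<longrightarrow> U (take j v) \<le> a"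
      then have "U \<in> ?N" using elim(2) by (fastforce simp: E_def J_def)
      with elim(1) show False by blast
    qed
  qed
qed

lemma same_entropyI:
  assumes d: "\<And>v. 0 < d v" and \<mu>: "1 < \<mu>"
    and AE: "AE U in PiM UNIV (\<lambda>_. unif01).
      (\<forall>a>1 / \<mu>. finite {v \<in> invasion_cluster (gw_tree d) U. a < U v}) \<and>
      (\<forall>v. \<exists>n. \<not> open_path (1 / \<mu>) n (\<lambda>w. (d (v @ w), U (v @ w))))"
  shows "same_entropy \<mu> (gw_tree d)"
  unfolding same_entropy_def
proof (intro allI impI)
  fix S assume S: "S \<subseteq> rays (gw_tree d)" and "exponentially_small \<mu> S"
  then obtain \<epsilon> c where \<epsilon>: "0 < \<epsilon>" "\<epsilon> < \<mu>" and card: "\<And>n. real (card (level S n)) \<le> c * (\<mu> - \<epsilon>) ^ n"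
    unfolding exponentially_small_def by blast
  let ?Y = "PiM UNIV (\<lambda>_::vertex. unif01)"
  define T where "T = gw_tree d"
  \<comment> \<open>A level above criticality that still beats the growth rate:
    \<open>(\<mu> - \<epsilon>) * a < 1\<close> is possible because \<open>1 / \<mu>\<close> is
    smaller than \<open>1 / (\<mu> - \<epsilon>)\<close>.\<close>
  have "1 / \<mu> < min 1 (1 / (\<mu> - \<epsilon>))" using \<mu> \<epsilon> by (simp add: field_simps)
  then obtain a where a: "1 / \<mu> < a" "a < min 1 (1 / (\<mu> - \<epsilon>))" using dense by blast
  have "0 < 1 / \<mu>" using \<mu> by simp
  with a have a0: "0 < a" "a < 1" by (blast intro: less_trans) (use a in simp)
  have qa: "(\<mu> - \<epsilon>) * a < 1" using a \<epsilon> by (simp add: field_simps)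
  \<comment> \<open>The closure of \<open>S\<close> in the boundary: a measurable superset built
    from the levels of \<open>S\<close> alone, which matters because \<open>S\<close> itself may
    fail to be measurable.\<close>
  define N where "N = {\<gamma> \<in> rays T. \<forall>n. \<gamma> n \<in> level S n}"
  have SN: "S \<subseteq> N"
    using S by (auto simp: N_def T_def level_def length_rays)
  have sets_ray: "sets (ray_space T) = sigma_sets (rays T) {{\<gamma> \<in> rays T. \<gamma> n = v} | n v. True}"
    unfolding ray_space_def by (rule sets_measure_of) auto
  have N: "N \<in> sets (ray_space T)"
  proof -
    have "{\<gamma> \<in> rays T. \<gamma> n = v} \<in> sets (ray_space T)" for n v
      unfolding sets_ray by (rule sigma_sets.Basic) blast
    then have "(\<Inter>n. \<Union>v\<in>level S n. {\<gamma> \<in> rays T. \<gamma> n = v}) \<in> sets (ray_space T)"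
      by (intro sets.countable_INT sets.countable_UN') auto
    moreover have "(\<Inter>n. \<Union>v\<in>level S n. {\<gamma> \<in> rays T. \<gamma> n = v}) = N" by (auto simp: N_def)
    ultimately show ?thesis by simp
  qed
  have "AE U in ?Y. \<forall>k. \<not> (\<forall>n. \<exists>v\<in>level S n. \<forall>j. k < j \<longrightarrow> j \<le> n \<longrightarrow> U (take j v) \<le> a)"
    unfolding AE_all_countable
    using AE_not_eventually_low[OF S card a0 _ qa] \<epsilon> by simp
  with AE AE_weights_inj have "AE U in ?Y. invasion_path T U \<notin> N"
  proof eventually_elim
    case (elim U)
    let ?C = "invasion_cluster T U"
    have ex1: "\<exists>!\<gamma>. \<gamma> \<in> rays ?C"
      unfolding T_def by (rule unique_ray_invasion_cluster[where q = "1 / \<mu>"]) (use elim d in auto)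
    define \<gamma> where "\<gamma> = invasion_path T U"
    have \<gamma>: "\<gamma> \<in> rays ?C"
      using theI'[OF ex1] ex1 by (simp add: \<gamma>_def invasion_path_def)
    \<comment> \<open>Finitely many large weights in the cluster leave a height \<open>k\<close>
      beyond which the invasion path has only weights at most \<open>a\<close>.\<close>
    have "finite (length ` {v \<in> ?C. a < U v})" using elim(1) a(1) by (simp add: T_def)
    then obtain k where k: "\<And>v. v \<in> ?C \<Longrightarrow> a < U v \<Longrightarrow> length v \<le> k"
      by (auto simp: finite_nat_set_iff_bounded_le)
    show ?case
    proof
      assume "invasion_path T U \<in> N"
      then have lev: "\<gamma> n \<in> level S n" for n by (simp add: N_def \<gamma>_def)
      have "U (take j (\<gamma> n)) \<le> a" if "k < j" "j \<le> n" for j n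
        using k[of "\<gamma> j"] rays_mem[OF \<gamma>, of j] take_rays[OF \<gamma> that(2)] length_rays[OF \<gamma>, of j] that
        by force
      with lev have "\<forall>n. \<exists>v\<in>level S n. \<forall>j. k < j \<longrightarrow> j \<le> n \<longrightarrow> U (take j v) \<le> a" by blast
      with elim(3) show False by blast
    qed
  qed
  then obtain X where X: "X \<in> null_sets ?Y" "invasion_path T -` N \<inter> space ?Y \<subseteq> X"
    by (auto simp: eventually_ae_filter)
  have "emeasure (invasion_measure T) N \<le> emeasure ?Y X"
    unfolding invasion_measure_def
    by (rule order_trans[OF emeasure_distr_le emeasure_mono]) (use X in auto)
  then have "N \<in> null_sets (invasion_measure T)"
    using X(1) N by (intro null_setsI) (auto simp: null_setsD1 invasion_measure_def)
  then show "S \<in> null_sets (completion (invasion_measure (gw_tree d)))"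
    using null_sets_completion_subset[OF SN null_sets_completionI] by (simp add: T_def)
qed

theorem theorem2p8:
  fixes p :: "nat pmf" and \<mu> :: real
  assumes "0 \<notin> set_pmf p"
    and "\<mu> = measure_pmf.expectation p real"
    and "\<mu> > 1"
    and "integrable (measure_pmf p) (\<lambda>k. (real k)\<^sup>2)"
  shows "AE \<omega> in gw_measure p. same_entropy \<mu> (gw_tree (\<lambda>v. fst (\<omega> v)))"
proof -
  let ?C = "\<lambda>\<omega>. invasion_cluster (gw_tree (\<lambda>u. fst (\<omega> u))) (\<lambda>u. snd (\<omega> u))"
  \<comment> \<open>A non-integrable function has integral 0 by convention, which contradicts a mean
    above 1.\<close>
  have int: "integrable (measure_pmf p) real"
    using assms(2,3) not_integrable_integral_eq[of "measure_pmf p" real] by force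
  \<comment> \<open>Rational levels keep the exceptional sets countable in number. Levels up to 1
    are the range of the supercritical estimate; a larger \<open>a\<close> is handled by a rational
    below \<open>min 1 a\<close>.\<close>
  have "AE \<omega> in gw_measure p. \<forall>r::rat. 1 / \<mu> < of_rat r \<longrightarrow> of_rat r \<le> (1::real) \<longrightarrow>
      finite {v \<in> ?C \<omega>. of_rat r < snd (\<omega> v)}"
    unfolding AE_all_countable
  proof (intro allI)
    fix r :: rat
    show "AE \<omega> in gw_measure p. 1 / \<mu> < of_rat r \<longrightarrow> of_rat r \<le> (1::real) \<longrightarrow>
      finite {v \<in> ?C \<omega>. of_rat r < snd (\<omega> v)}"
    proof (cases "1 / \<mu> < of_rat r \<and> of_rat r \<le> (1::real)")
      case True
      then obtain h where "0 < h" "\<And>n. h \<le> open_prob p (of_rat r) n"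
        using open_prob_supercritical[OF int assms(4,2,3), of "of_rat r"] by blast
      from AE_finite_invaded_above[OF assms(1) this] show ?thesis by eventually_elim simp
    qed auto
  qed
  then have "AE \<omega> in gw_measure p. \<forall>a>1 / \<mu>. finite {v \<in> ?C \<omega>. a < snd (\<omega> v)}"
  proof eventually_elim
    case (elim \<omega>)
    show ?case
    proof (intro allI impI)
      fix a assume "1 / \<mu> < a"
      then have "1 / \<mu> < min 1 a" using assms(3) by simp
      then obtain r where r: "1 / \<mu> < of_rat r" "of_rat r < min 1 a"
        using of_rat_dense by blast
      then have "finite {v \<in> ?C \<omega>. of_rat r < snd (\<omega> v)}" using elim by simp
      then show "finite {v \<in> ?C \<omega>. a < snd (\<omega> v)}"
        by (rule rev_finite_subset) (use r in auto)
    qed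
  qed
  with AE_no_critical_path[OF int assms(2,3)]
  have "AE \<omega> in PiM UNIV (\<lambda>_. measure_pmf p \<Otimes>\<^sub>M unif01).
      (\<forall>a>1 / \<mu>. finite {v \<in> ?C \<omega>. a < snd (\<omega> v)}) \<and>
      (\<forall>v. \<exists>n. \<not> open_path (1 / \<mu>) n (\<lambda>w. \<omega> (v @ w)))"
    unfolding gw_measure_def[symmetric] by eventually_elim simp
  \<comment> \<open>Split the joint law into degrees and weights, then regard the statement about
    degrees as one about the labelled tree again.\<close>
  from AE_PiM_fst[OF _ _ AE_PiM_pair[OF _ _ this], of "\<lambda>_. unif01"]
  have "AE \<omega> in gw_measure p. AE U in PiM UNIV (\<lambda>_. unif01).
      (\<forall>a>1 / \<mu>. finite {v \<in> invasion_cluster (gw_tree (\<lambda>u. fst (\<omega> u))) U. a < U v}) \<and>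
      (\<forall>v. \<exists>n. \<not> open_path (1 / \<mu>) n (\<lambda>w. (fst (\<omega> (v @ w)), U (v @ w))))"
    unfolding gw_measure_def by (simp add: measure_pmf.prob_space_axioms prob_space_unif01)
  with AE_deg_pos[OF assms(1)] show ?thesis
    by eventually_elim (rule same_entropyI[OF _ assms(3)], auto)
qed

end
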